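(* Let $R:\widehat{\mathbb{C}}\to\widehat{\mathbb{C}}$ be a rational map of degree at least $2$, and let $x\in\widehat{\mathbb{C}}$ be such that $R(x)$ is not a critical value of $R$. Then there exist two distinct critical points $\zeta$ and $\kappa$ of $R$ such that there is a unique Möbius map $M$ for which $x$, $\zeta$ and $\kappa$ are fixed points of $M\circ R$, and this $M$ satisfies $|(M\circ R)^{\#}(x)|\ge\frac12$.
   Context: $\widehat{\mathbb{C}}=\mathbb{C}\cup\{\infty\}$ is the Riemann sphere. A critical point of a rational map $R$ is a point of $\widehat{\mathbb{C}}$ at which the derivative of $R$, computed in local coordinates, vanishes (equivalently, $R$ is not locally injective there); a critical value is the image under $R$ of a critical point. For a rational map $f$ and a point $x\in\widehat{\mathbb{C}}$ with $f(x)=x$, $f^{\#}(x)$ denotes the multiplier of $f$ at $x$, i.e. the derivative of $f$ at $x$ with respect to any local coordinate at $x$ (the same coordinate being used in source and target). *)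

theory Defs
  imports "HOL-Analysis.Analysis" "HOL-Computational_Algebra.Computational_Algebra"
begin

(* The Riemann sphere: None is the point at infinity, Some z the finite point z.
   This is the carrier of the library's one-point compactification
   (Alexandroff_extension) of the complex plane. *)
type_synonym riemann_sphere = "complex option"

(* The map p/q on the sphere, for coprime p and q. At infinity, p/q has as its value the
   ratio of the coefficients of order max (degree p) (degree q), not both of which vanish. *)
definition rat_fun :: "complex poly \<Rightarrow> complex poly \<Rightarrow> riemann_sphere \<Rightarrow> riemann_sphere" where
  "rat_fun p q w =
     (case w of
        Some z \<Rightarrow> if poly q z = 0 then None else Some (poly p z / poly q z)
      | None \<Rightarrow> (let n = max (degree p) (degree q) in
                 if coeff q n = 0 then None else Some (coeff p n / coeff q n)))"

definition rational_map_of_degree :: "nat \<Rightarrow> (riemann_sphere \<Rightarrow> riemann_sphere) \<Rightarrow> bool" where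
  "rational_map_of_degree n f \<longleftrightarrow>
     (\<exists>p q. coprime p q \<and> n = max (degree p) (degree q) \<and> f = rat_fun p q)"

(* M is the map sending z to (a * z + b) / (c * z + d). *)
definition moebius_map :: "(riemann_sphere \<Rightarrow> riemann_sphere) \<Rightarrow> bool" where
  "moebius_map M \<longleftrightarrow>
     (\<exists>a b c d. a * d - b * c \<noteq> 0 \<and> M = rat_fun [:b, a:] [:d, c:])"

(* Standard local coordinate at the point w: the identity for finite w, and z \<mapsto> 1/z for
   w at infinity. The coordinate is only meaningful near w; its values at infinity (w finite)
   and at Some 0 (w infinite) are arbitrary. *)
definition local_coord :: "riemann_sphere \<Rightarrow> riemann_sphere \<Rightarrow> complex" where
  "local_coord w v =
     (case w of
        Some _ \<Rightarrow> (case v of Some z \<Rightarrow> z | None \<Rightarrow> 0)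
      | None \<Rightarrow> (case v of Some z \<Rightarrow> 1 / z | None \<Rightarrow> 0))"

(* Inverse of the coordinate at w. *)
definition local_param :: "riemann_sphere \<Rightarrow> complex \<Rightarrow> riemann_sphere" where
  "local_param w u =
     (case w of
        Some _ \<Rightarrow> Some u
      | None \<Rightarrow> (if u = 0 then None else Some (1 / u)))"

(* f read in the coordinates at w (source) and at f w (target). *)
definition local_rep ::
    "(riemann_sphere \<Rightarrow> riemann_sphere) \<Rightarrow> riemann_sphere \<Rightarrow> complex \<Rightarrow> complex" where
  "local_rep f w = local_coord (f w) \<circ> f \<circ> local_param w"

definition critical_point :: "(riemann_sphere \<Rightarrow> riemann_sphere) \<Rightarrow> riemann_sphere \<Rightarrow> bool" where
  "critical_point f w \<longleftrightarrow> (local_rep f w has_field_derivative 0) (at (local_coord w w))"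

definition critical_value :: "(riemann_sphere \<Rightarrow> riemann_sphere) \<Rightarrow> riemann_sphere \<Rightarrow> bool" where
  "critical_value f v \<longleftrightarrow> (\<exists>w. critical_point f w \<and> f w = v)"

(* Meant for f w = w, where local_rep uses the same coordinate in source and target. *)
definition multiplier :: "(riemann_sphere \<Rightarrow> riemann_sphere) \<Rightarrow> riemann_sphere \<Rightarrow> complex" where
  "multiplier f w = deriv (local_rep f w) (local_coord w w)"

end

theory Submission
  imports Defs "HOL-Complex_Analysis.Complex_Analysis"
begin

text \<open>
  Moebius changes of coordinate in the source and in the target reduce the theorem to the case
  \<open>x = \<infinity> = R(x)\<close>. As \<open>\<infinity>\<close> is not a critical value, \<open>R = p / q\<close> then has only simple poles, one of
  them at \<open>\<infinity>\<close>, so that \<open>deg q = deg p - 1\<close>; the critical points are the zeros of the Wronskian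
  \<open>p' q - p q'\<close>. A Moebius map \<open>M\<close> with \<open>M(\<infinity>) = \<infinity>\<close> is affine, it is determined by \<open>M(R(\<zeta>)) = \<zeta>\<close> and
  \<open>M(R(\<kappa>)) = \<kappa>\<close> as soon as \<open>R(\<zeta>) \<noteq> R(\<kappa>)\<close>, and the multiplier at \<open>\<infinity>\<close> has modulus
  \<open>\<bar>R(\<zeta>) - R(\<kappa>)\<bar> / (\<bar>L\<bar> \<bar>\<zeta> - \<kappa>\<bar>)\<close> where \<open>R(z) \<sim> L z\<close>. So two critical points with
  \<open>\<bar>L\<bar> \<bar>\<zeta> - \<kappa>\<bar> \<le> 2 \<bar>R(\<zeta>) - R(\<kappa>)\<bar> \<noteq> 0\<close> are needed (\<open>critical_pair_normalised\<close>).

  Choose them so that their critical values are as far apart as possible, at distance \<open>d\<close>. A degree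
  count shows that there is more than one critical value, so \<open>d > 0\<close>
  (\<open>critical_value_not_unique\<close>). The convex hull \<open>E\<close> of the critical values has diameter \<open>d\<close>, and
  \<open>R\<close> is a covering map over its complement (\<open>covering_space_poly_quotient\<close>), which is simply
  connected in the sphere. Hence the branch of \<open>R\<^sup>-\<^sup>1\<close> at \<open>\<infinity>\<close> extends to the complement of \<open>E\<close>.
  Its composition with the Riemann map of the disc onto that complement is injective and omits
  every critical point. Two inequalities of capacity type finish the proof: a set of diameter \<open>d\<close> has
  capacity at most \<open>d / 2\<close> (\<open>exterior_riemann_map\<close>), and the complement of the image of an injective
  map has diameter at most four times its capacity. If \<open>\<zeta>\<close> is moved to \<open>\<infinity>\<close> by
  \<open>z = \<zeta> + 1 / s\<close>, the second one becomes the Koebe quarter theorem (\<open>koebe_quarter\<close>). Together they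
  give \<open>4 \<cdot> d / 2 = 2 d\<close>.

  The quarter theorem is derived from a lower bound for polynomials instead of the area theorem.
  If \<open>k\<close> is injective on the disc with \<open>k(0) = 0\<close>, then the coefficient of \<open>z\<^sup>n\<close> in
  \<open>1 / (1 - v k(z))\<close> is a polynomial in \<open>v\<close> of degree \<open>n\<close> with leading coefficient \<open>k'(0)\<^sup>n\<close>. By Cauchy's
  inequality it is at most \<open>C \<rho>\<^sup>-\<^sup>n\<close> for every \<open>\<rho> < 1\<close> when \<open>1 / v\<close> is an omitted value, with
  \<open>C\<close> independent of \<open>n\<close> and \<open>v\<close>, while a monic polynomial of degree \<open>n\<close> reaches modulus \<open>(L/4)\<^sup>n\<close> on every set that meets all the
  circles of radius at most \<open>L\<close> about \<open>0\<close>.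
\<close>

section \<open>Complex polynomials, Wronskians and critical values\<close>

lemma coprime_complex_poly_iff:
  fixes p q :: "complex poly"
  shows "coprime p q \<longleftrightarrow> (\<forall>z. poly p z \<noteq> 0 \<or> poly q z \<noteq> 0)"
proof
  assume *: "\<forall>z. poly p z \<noteq> 0 \<or> poly q z \<noteq> 0"
  show "coprime p q"
  proof (rule coprimeI)
    fix c assume c: "c dvd p" "c dvd q"
    have "\<not> (\<exists>z. poly c z = 0)"
      using * c by (metis poly_0 mult_zero_left poly_mult dvdE)
    then have "c \<noteq> 0" "constant (poly c)"
      using Fundamental_Theorem_Algebra.fundamental_theorem_of_algebra by auto
    then show "is_unit c"
      by (simp add: constant_degree is_unit_iff_degree)
  qed
qed (use coprime_poly_0 in blast)

text \<open>Together with \<open>coprime_complex_poly_iff\<close> this says that the homogeneous forms belonging to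
  \<open>p\<close> and \<open>q\<close> have no common zero on the sphere, \<open>\<infinity>\<close> included.\<close>

lemma coprime_coeff_max_degree:
  fixes p q :: "complex poly"
  assumes "coprime p q"
  shows "coeff p (max (degree p) (degree q)) \<noteq> 0 \<or> coeff q (max (degree p) (degree q)) \<noteq> 0"
proof (rule ccontr)
  assume *: "\<not> ?thesis"
  have "p = 0 \<and> q = 0"
  proof (cases "degree p \<le> degree q")
    case True
    with * have "q = 0" "coeff p (degree q) = 0" by (auto simp: max_absorb2)
    then show ?thesis using True by (metis degree_0 le_zero_eq leading_coeff_0_iff)
  next
    case False
    with * show ?thesis by (auto simp: max_absorb1)
  qed
  then show False using assms by simp
qed

lemma max_degree_eqI:
  assumes "degree p \<le> n" "degree q \<le> n" "coeff p n \<noteq> 0 \<or> coeff q n \<noteq> 0"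
  shows "max (degree p) (degree q) = n"
  using assms by (metis le_degree max.absorb1 max.absorb2 le_antisym)

text \<open>The numerator of the derivative of \<open>p / q\<close>.\<close>

definition wronskian :: "complex poly \<Rightarrow> complex poly \<Rightarrow> complex poly" where
  "wronskian p q = pderiv p * q - p * pderiv q"

text \<open>Adding a constant to \<open>p / q\<close> does not change its derivative.\<close>

lemma wronskian_add_smult: "wronskian (p + smult v q) q = wronskian p q"
  by (simp add: wronskian_def pderiv_add pderiv_smult algebra_simps)

lemma wronskian_diff_smult: "wronskian (p - smult v q) q = wronskian p q"
  using wronskian_add_smult[of p "-v" q] by simp

lemma has_field_derivative_poly_quotient:
  fixes z :: complex
  assumes "poly q z \<noteq> 0"
  shows "((\<lambda>u. poly p u / poly q u) has_field_derivative poly (wronskian p q) z / poly q z ^ 2) (at z)"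
  using assms by (auto intro!: derivative_eq_intros simp: wronskian_def power2_eq_square)

text \<open>The polynomial \<open>s\<^sup>n p(a + 1 / s)\<close>: it describes \<open>p\<close>, as a form of degree \<open>n\<close>, in
  the coordinate \<open>s = 1 / (z - a)\<close>, which moves \<open>a\<close> to \<open>\<infinity>\<close> and \<open>\<infinity>\<close> to \<open>0\<close>.\<close>

definition reverse_at :: "nat \<Rightarrow> complex \<Rightarrow> complex poly \<Rightarrow> complex poly" where
  "reverse_at n a p = (\<Sum>i\<le>n. monom (coeff (pcompose p [:a, 1:]) i) (n - i))"

lemma coeff_pcompose_shift:
  fixes p :: "complex poly"
  assumes "degree p \<le> n"
  shows "coeff (pcompose p [:a, 1:]) n = coeff p n"
proof (cases "degree p = n")
  case True
  then show ?thesis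
    using lead_coeff_comp[of "[:a, 1:]" p] by (simp add: degree_pcompose)
next
  case False
  then show ?thesis
    using assms by (simp add: coeff_eq_0 degree_pcompose)
qed

lemma coeff_reverse_at:
  "coeff (reverse_at n a p) i = (if i \<le> n then coeff (pcompose p [:a, 1:]) (n - i) else 0)"
proof -
  have "coeff (reverse_at n a p) i =
      (\<Sum>j\<le>n. if n - j = i then coeff (pcompose p [:a, 1:]) j else 0)"
    by (simp add: reverse_at_def coeff_sum)
  also have "\<dots> = (\<Sum>j\<le>n. if i \<le> n \<and> j = n - i then coeff (pcompose p [:a, 1:]) j else 0)"
    by (intro sum.cong) auto
  finally show ?thesis by simp
qed

lemma degree_reverse_at_le: "degree (reverse_at n a p) \<le> n"
  by (rule degree_le) (simp add: coeff_reverse_at)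

lemma coeff_reverse_at_top: "coeff (reverse_at n a p) n = poly p a"
  by (simp add: coeff_reverse_at flip: poly_0_coeff_0) (simp add: poly_pcompose)

lemma poly_reverse_at_0: "degree p \<le> n \<Longrightarrow> poly (reverse_at n a p) 0 = coeff p n"
  by (simp add: poly_0_coeff_0 coeff_reverse_at coeff_pcompose_shift)

lemma poly_pderiv_reverse_at_0:
  "degree p < n \<Longrightarrow> poly (pderiv (reverse_at n a p)) 0 = coeff p (n - 1)"
  by (simp add: poly_0_coeff_0 coeff_pderiv coeff_reverse_at coeff_pcompose_shift)

lemma poly_reverse_at:
  assumes "degree p \<le> n" "s \<noteq> 0"
  shows "poly (reverse_at n a p) s = s ^ n * poly p (a + 1 / s)"
proof -
  define r where "r = pcompose p [:a, 1:]"
  have "degree r \<le> n" using assms by (simp add: r_def degree_pcompose)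
  have "poly (reverse_at n a p) s = (\<Sum>i\<le>n. coeff r i * s ^ (n - i))"
    by (simp add: reverse_at_def poly_sum poly_monom r_def)
  also have "\<dots> = (\<Sum>i\<le>n. s ^ n * (coeff r i * (1 / s) ^ i))"
    using assms(2) by (intro sum.cong) (auto simp: power_diff power_divide)
  also have "\<dots> = s ^ n * (\<Sum>i\<le>n. coeff r i * (1 / s) ^ i)"
    by (simp add: sum_distrib_left)
  also have "(\<Sum>i\<le>n. coeff r i * (1 / s) ^ i) = poly r (1 / s)"
    unfolding poly_altdef using \<open>degree r \<le> n\<close>
    by (intro sum.mono_neutral_right) (auto simp: coeff_eq_0)
  finally show ?thesis by (simp add: r_def poly_pcompose)
qed

lemma poly_pderiv_reverse_at:
  assumes "degree p \<le> n" "s \<noteq> 0"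
  shows "s ^ 2 * poly (pderiv (reverse_at n a p)) s =
    of_nat n * s * (s ^ n * poly p (a + 1 / s)) - s ^ n * poly (pderiv p) (a + 1 / s)"
proof -
  have "((\<lambda>s. s ^ n * poly p (a + 1 / s)) has_field_derivative
      of_nat n * s ^ (n - 1) * poly p (a + 1 / s) + s ^ n * (poly (pderiv p) (a + 1 / s) * (- 1 / s ^ 2))) (at s)"
    using assms(2) by (auto intro!: derivative_eq_intros simp: power2_eq_square)
  moreover have "\<forall>\<^sub>F s in nhds s. s ^ n * poly p (a + 1 / s) = poly (reverse_at n a p) s"
    using t1_space_nhds[OF assms(2)] by eventually_elim (simp add: poly_reverse_at assms(1))
  ultimately have "((\<lambda>s. poly (reverse_at n a p) s) has_field_derivative
      of_nat n * s ^ (n - 1) * poly p (a + 1 / s) + s ^ n * (poly (pderiv p) (a + 1 / s) * (- 1 / s ^ 2))) (at s)"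
    by (simp add: DERIV_cong_ev)
  then have D: "poly (pderiv (reverse_at n a p)) s =
      of_nat n * s ^ (n - 1) * poly p (a + 1 / s) + s ^ n * (poly (pderiv p) (a + 1 / s) * (- 1 / s ^ 2))"
    using poly_DERIV DERIV_unique by blast
  show ?thesis
    unfolding D using assms(2) by (cases n) (simp_all add: field_simps power2_eq_square)
qed

text \<open>The substitution \<open>z = a + 1 / s\<close> has nowhere vanishing derivative, so it preserves the zeros
  of the Wronskian; the power \<open>s\<^sup>2\<close> stays on the left because \<open>s\<^bsup>2n-2\<^esup>\<close> would
  involve a truncated subtraction.\<close>

lemma wronskian_reverse_at:
  assumes "degree p \<le> n" "degree q \<le> n" "s \<noteq> 0"
  shows "s ^ 2 * poly (wronskian (reverse_at n a p) (reverse_at n a q)) s =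
    - ((s ^ n) ^ 2 * poly (wronskian p q) (a + 1 / s))"
proof -
  have "s ^ 2 * poly (wronskian (reverse_at n a p) (reverse_at n a q)) s =
      (s ^ 2 * poly (pderiv (reverse_at n a p)) s) * poly (reverse_at n a q) s
    - poly (reverse_at n a p) s * (s ^ 2 * poly (pderiv (reverse_at n a q)) s)"
    by (simp add: wronskian_def algebra_simps)
  also have "\<dots> = - ((s ^ n) ^ 2 * poly (wronskian p q) (a + 1 / s))"
    unfolding poly_pderiv_reverse_at[OF assms(1,3)] poly_pderiv_reverse_at[OF assms(2,3)]
      poly_reverse_at[OF assms(1,3)] poly_reverse_at[OF assms(2,3)]
    by (simp add: wronskian_def power2_eq_square algebra_simps)
  finally show ?thesis .
qed

lemma coprime_reverse_at:
  assumes "coprime p q" "max (degree p) (degree q) = n"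
  shows "coprime (reverse_at n a p) (reverse_at n a q)"
    and "max (degree (reverse_at n a p)) (degree (reverse_at n a q)) = n"
proof -
  have le: "degree p \<le> n" "degree q \<le> n" using assms(2) by auto
  have "coeff p n \<noteq> 0 \<or> coeff q n \<noteq> 0"
    using coprime_coeff_max_degree[OF assms(1)] assms(2) by simp
  then show "coprime (reverse_at n a p) (reverse_at n a q)"
    using assms(1) unfolding coprime_complex_poly_iff
    by (metis le mult_eq_0_iff power_not_zero poly_reverse_at poly_reverse_at_0)
  have "coeff (reverse_at n a p) n \<noteq> 0 \<or> coeff (reverse_at n a q) n \<noteq> 0"
    using assms(1) by (auto simp: coprime_complex_poly_iff coeff_reverse_at_top)
  then show "max (degree (reverse_at n a p)) (degree (reverse_at n a q)) = n"
    by (intro max_degree_eqI degree_reverse_at_le)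
qed

lemma degree_eq_sum_order:
  fixes p :: "complex poly"
  assumes "p \<noteq> 0"
  shows "degree p = (\<Sum>z | poly p z = 0. order z p)"
proof -
  have "degree p = degree (\<Prod>z|poly p z = 0. [:-z, 1:] ^ order z p)"
    using assms by (subst complex_poly_decompose[symmetric]) simp
  also have "\<dots> = (\<Sum>z | poly p z = 0. order z p)"
    by (subst degree_prod_eq_sum_degree) (auto simp: degree_power_eq)
  finally show ?thesis .
qed

text \<open>The terms of degree \<open>2 n - 2\<close> in \<open>p' q\<close> and \<open>p q'\<close> have the factors \<open>n\<close> and \<open>n - 1\<close>, so
  they do not cancel.\<close>

lemma degree_wronskian_ge:
  assumes n: "degree p = n" "degree q = n - 1" "n \<ge> 2"
  shows "2 * n - 2 \<le> degree (wronskian p q)"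
proof -
  have "coeff (pderiv p * q) (degree (pderiv p) + degree q) = lead_coeff (pderiv p) * lead_coeff q"
    "coeff (p * pderiv q) (degree p + degree (pderiv q)) = lead_coeff p * lead_coeff (pderiv q)"
    by (rule coeff_mult_degree_sum)+
  moreover have "degree (pderiv p) + degree q = 2 * n - 2" "degree p + degree (pderiv q) = 2 * n - 2"
    using n by (auto simp: degree_pderiv)
  ultimately have "coeff (wronskian p q) (2 * n - 2) =
      of_nat n * lead_coeff p * lead_coeff q - lead_coeff p * (of_nat (n - 1) * lead_coeff q)"
    using n by (simp add: wronskian_def degree_pderiv coeff_pderiv Suc_diff_Suc numeral_2_eq_2)
  also have "\<dots> = lead_coeff p * lead_coeff q"
    using n by (simp add: of_nat_diff algebra_simps)
  also have "\<dots> \<noteq> 0"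
  proof -
    have "p \<noteq> 0" "q \<noteq> 0" using n by auto
    then show ?thesis by simp
  qed
  finally show ?thesis by (rule le_degree)
qed

text \<open>If every zero of the Wronskian \<open>W\<close> were a zero of \<open>P = p - v q\<close>, its multiplicity in \<open>W\<close> would be
  one less than in \<open>P\<close>, hence at most the one in \<open>P'\<close>. Summing over the zeros would bound the degree of \<open>W\<close>, which is
  at least \<open>2 n - 2\<close>, by \<open>deg P' = n - 1\<close>.\<close>

lemma critical_value_not_unique:
  assumes "coprime p q" and n: "degree p = n" "degree q = n - 1" "n \<ge> 2"
  shows "\<exists>z. poly (wronskian p q) z = 0 \<and> poly p z \<noteq> v * poly q z"
proof (rule ccontr)
  assume contr: "\<not> ?thesis"
  define P where "P = p - smult v q"
  define W where "W = wronskian P q"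
  have W: "W = wronskian p q" by (simp add: W_def P_def wronskian_diff_smult)
  have dW: "2 * n - 2 \<le> degree W"
    unfolding W by (rule degree_wronskian_ge[OF n])
  then have W0: "W \<noteq> 0" using n by auto
  have degP: "degree P = n"
    unfolding P_def using n degree_smult_le[of v q]
    by (subst diff_conv_add_uminus, subst degree_add_eq_left) (auto simp: )
  have P0: "P \<noteq> 0" using degP n by auto
  have P'0: "pderiv P \<noteq> 0" using degP n by (simp add: pderiv_eq_0_iff)
  have ord: "order z W \<le> order z (pderiv P)" and root: "poly (pderiv P) z = 0" if z: "poly W z = 0" for z
  proof -
    have Pz: "poly P z = 0" using contr z by (auto simp: W P_def)
    have qz: "poly q z \<noteq> 0"
      using assms(1) Pz by (auto simp: coprime_complex_poly_iff P_def)
    define m where "m = order z P"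
    have m: "m = Suc (order z (pderiv P))"
      unfolding m_def by (rule order_pderiv[OF P0 Pz])
    have "\<not> [:-z, 1:] ^ m dvd W"
    proof
      assume "[:-z, 1:] ^ m dvd W"
      moreover have "[:-z, 1:] ^ m dvd P * pderiv q"
        unfolding m_def by (intro dvd_mult2 order_1)
      moreover have "pderiv P * q = W + P * pderiv q"
        by (simp add: W_def wronskian_def)
      ultimately have "[:-z, 1:] ^ m dvd pderiv P * q"
        using dvd_add by metis
      moreover have "pderiv P * q \<noteq> 0" using P'0 qz by auto
      ultimately have "m \<le> order z (pderiv P * q)"
        by (simp add: order_divides)
      also have "\<dots> = order z (pderiv P)"
        using \<open>pderiv P * q \<noteq> 0\<close> qz by (simp add: order_mult order_0I)
      finally show False using m by simp
    qed
    then have "order z W < m" using W0 by (simp add: order_divides not_le)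
    then show "order z W \<le> order z (pderiv P)" using m by simp
    moreover have "order z W \<noteq> 0" using W0 z by (simp add: order_root)
    ultimately show "poly (pderiv P) z = 0" by (metis le_zero_eq order_0I)
  qed
  have "degree W = (\<Sum>z | poly W z = 0. order z W)"
    by (rule degree_eq_sum_order[OF W0])
  also have "\<dots> \<le> (\<Sum>z | poly W z = 0. order z (pderiv P))"
    by (rule sum_mono) (use ord in auto)
  also have "\<dots> \<le> (\<Sum>z | poly (pderiv P) z = 0. order z (pderiv P))"
    by (rule sum_mono2) (use root poly_roots_finite[OF P'0] in auto)
  also have "\<dots> \<le> degree (pderiv P)"
    by (rule sum_order_le_degree[OF P'0])
  also have "\<dots> = n - 1" by (simp add: degree_pderiv degP)
  finally show False using dW n by simp
qed

section \<open>The Koebe quarter theorem\<close>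

text \<open>A Chebyshev-type bound. With \<open>x = (L/4) (1 + \<xi>)\<^sup>2 / \<xi>\<close> the unit circle is mapped onto
  \<open>{0..L}\<close>, and multiplying the \<open>i\<close>-th factor \<open>x - t i\<close> by \<open>\<xi>\<close> gives a polynomial in \<open>\<xi>\<close> with the value \<open>L/4\<close> at
  \<open>0\<close>. The maximum principle for the product of these polynomials is the claim.\<close>

lemma prod_dist_large_on_interval:
  fixes t :: "nat \<Rightarrow> real" and L :: real
  assumes "L \<ge> 0"
  shows "\<exists>x\<in>{0..L}. (L/4)^n \<le> (\<Prod>i<n. \<bar>x - t i\<bar>)"
proof -
  define G where "G = (\<lambda>\<xi>::complex. \<Prod>i<n. of_real (L/4) * (1 + \<xi>)^2 - of_real (t i) * \<xi>)"
  have holG: "G holomorphic_on A" for A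
    unfolding G_def by (intro holomorphic_intros)
  have contG: "continuous_on A G" for A
    using holG holomorphic_on_imp_continuous_on by blast
  have "\<exists>\<xi>\<in>sphere 0 1. \<forall>\<eta>\<in>sphere 0 1. cmod (G \<eta>) \<le> cmod (G \<xi>)"
    by (intro continuous_attains_sup continuous_on_norm contG) auto
  then obtain \<xi> where \<xi>: "cmod \<xi> = 1" and max: "\<And>\<eta>. cmod \<eta> = 1 \<Longrightarrow> cmod (G \<eta>) \<le> cmod (G \<xi>)"
    by auto
  have "cmod (G 0) \<le> cmod (G \<xi>)"
    by (rule maximum_modulus_frontier[of G "cball 0 1"]) (auto intro: holG contG max)
  moreover have "G 0 = of_real ((L/4)^n)"
    by (simp add: G_def)
  ultimately have ge: "(L/4)^n \<le> cmod (G \<xi>)"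
    using assms by (simp add: norm_power norm_divide)
  define x where "x = L/2 * (1 + Re \<xi>)"
  have "\<bar>Re \<xi>\<bar> \<le> 1"
    using abs_Re_le_cmod[of \<xi>] \<xi> by simp
  then have "0 \<le> 1 + Re \<xi>" "1 + Re \<xi> \<le> 2" by linarith+
  then have "x \<in> {0..L}"
    using assms mult_left_mono[of "1 + Re \<xi>" 2 "L/2"] by (auto simp: x_def)
  moreover have "cmod (G \<xi>) = (\<Prod>i<n. \<bar>x - t i\<bar>)"
  proof -
    have "cmod (of_real (L/4) * (1 + \<xi>)^2 - of_real (t i) * \<xi>) = \<bar>x - t i\<bar>" for i
    proof -
      have 1: "\<xi> * cnj \<xi> = 1"
        using \<xi> by (simp add: complex_norm_square [symmetric])
      have "(of_real (L/4) * (1 + \<xi>)^2 - of_real (t i) * \<xi>) * cnj \<xi>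
          = of_real (L/4) * (\<xi> * cnj \<xi> * 2 + (cnj \<xi> + \<xi> * (\<xi> * cnj \<xi>))) - of_real (t i) * (\<xi> * cnj \<xi>)"
        by (simp add: power2_eq_square algebra_simps)
      also have "\<dots> = of_real (L/4) * (2 + (\<xi> + cnj \<xi>)) - of_real (t i)"
        unfolding 1 by simp
      also have "\<dots> = of_real (x - t i)"
        unfolding complex_add_cnj x_def by (simp add: field_simps)
      finally have "cmod ((of_real (L/4) * (1 + \<xi>)^2 - of_real (t i) * \<xi>) * cnj \<xi>) = \<bar>x - t i\<bar>"
        by (simp only: norm_of_real)
      then show ?thesis
        by (simp add: norm_mult \<xi>)
    qed
    then show ?thesis
      by (simp add: G_def prod_norm [symmetric])
  qed
  ultimately show ?thesis
    using ge by metis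
qed

text \<open>Replacing \<open>v\<close> and the roots of \<open>p\<close> by their moduli can only decrease the distances between
  them, so the bound on the interval \<open>{0..L}\<close> applies.\<close>

lemma poly_large_on_radial_set:
  fixes p :: "complex poly"
  assumes "L \<ge> 0" and K: "\<And>t. 0 \<le> t \<Longrightarrow> t \<le> L \<Longrightarrow> \<exists>v\<in>K. cmod v = t"
  shows "\<exists>v\<in>K. cmod v \<le> L \<and> cmod (lead_coeff p) * (L/4) ^ degree p \<le> cmod (poly p v)"
proof -
  obtain r where r: "smult (lead_coeff p) (\<Prod>i<degree p. [:- r i, 1:]) = p"
    using complex_poly_decompose' by metis
  obtain x where x: "x \<in> {0..L}" "(L/4) ^ degree p \<le> (\<Prod>i<degree p. \<bar>x - cmod (r i)\<bar>)"
    using prod_dist_large_on_interval[OF assms(1), where t = "\<lambda>i. cmod (r i)"] by blast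
  obtain v where v: "v \<in> K" "cmod v = x"
    using K x(1) by fastforce
  have "poly p v = lead_coeff p * (\<Prod>i<degree p. v - r i)"
    by (subst r [symmetric]) (simp add: poly_prod)
  then have "cmod (poly p v) = cmod (lead_coeff p) * (\<Prod>i<degree p. cmod (v - r i))"
    by (simp add: norm_mult prod_norm)
  moreover have "(\<Prod>i<degree p. \<bar>x - cmod (r i)\<bar>) \<le> (\<Prod>i<degree p. cmod (v - r i))"
    unfolding v(2)[symmetric] by (intro prod_mono) (auto intro: norm_triangle_ineq3)
  ultimately show ?thesis
    using v x by (intro bexI[of _ v]) (auto intro!: mult_left_mono)
qed

text \<open>Expand \<open>1 / (1 - v k)\<close> as a geometric series. As \<open>k\<^sup>j\<close> vanishes to order \<open>j\<close> at \<open>0\<close>, only the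
  terms with \<open>j \<le> n\<close> contribute to the \<open>n\<close>-th Taylor coefficient, and the last one contributes
  \<open>k'(0)\<^sup>n v\<^sup>n\<close>.\<close>

lemma taylor_coeff_resolvent:
  fixes k :: "complex \<Rightarrow> complex"
  assumes k: "k analytic_on {0}" "k 0 = 0" and c: "deriv k 0 \<noteq> 0"
  obtains B where "degree B = n" "lead_coeff B = deriv k 0 ^ n"
    "\<And>v. (deriv ^^ n) (\<lambda>z. inverse (1 - v * k z)) 0 = fact n * poly B v"
proof -
  define F where "F = fps_expansion k 0"
  have F: "k has_fps_expansion F"
    unfolding F_def by (rule analytic_at_imp_has_fps_expansion_0[OF k(1)])
  have F0: "F $ 0 = 0" and F1: "F $ 1 = deriv k 0"
    using fps_nth_fps_expansion[OF F, of 0] fps_nth_fps_expansion[OF F, of 1] k(2) by auto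
  define B where "B = (\<Sum>j\<le>n. monom (F ^ j $ n) j)"
  have coeff: "coeff B i = (if i \<le> n then F ^ i $ n else 0)" for i
    by (auto simp: B_def coeff_sum)
  have lead: "coeff B n = deriv k 0 ^ n"
    using startsby_zero_power_nth_same[OF F0, of n] by (simp add: coeff F1[simplified])
  have deg: "degree B = n"
    by (rule antisym[OF degree_le le_degree]) (use lead c in \<open>auto simp: coeff\<close>)
  have "(deriv ^^ n) (\<lambda>z. inverse (1 - v * k z)) 0 = fact n * poly B v" for v
  proof -
    define X where "X = fps_const v * F"
    have X0: "X $ 0 = 0"
      by (simp add: X_def F0)
    have "(\<lambda>z. inverse (1 - v * k z)) has_fps_expansion inverse (1 - X)"
      unfolding X_def by (intro fps_expansion_intros F) (simp add: F0)
    then have "(deriv ^^ n) (\<lambda>z. inverse (1 - v * k z)) 0 = fact n * inverse (1 - X) $ n"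
      by (simp add: fps_nth_fps_expansion)
    also have "inverse (1 - X) = (\<Sum>j\<le>n. X ^ j) + X ^ Suc n * inverse (1 - X)"
    proof -
      have 1: "inverse (1 - X) * (1 - X) = 1"
        by (rule inverse_mult_eq_1) (simp add: X0)
      have "(\<Sum>j\<le>n. X ^ j) * (1 - X) = 1 - X ^ Suc n"
        using sum_gp_basic[of X n] by (simp add: mult.commute)
      then have "(\<Sum>j\<le>n. X ^ j) * (inverse (1 - X) * (1 - X)) = inverse (1 - X) * (1 - X ^ Suc n)"
        by (simp add: mult_ac)
      then show ?thesis
        unfolding 1 by (simp add: algebra_simps)
    qed
    also have "\<dots> $ n = (\<Sum>j\<le>n. X ^ j $ n)"
      by (simp add: fps_sum_nth fps_mult_nth startsby_zero_power_prefix[OF X0] del: power_Suc)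
    also have "\<dots> = poly B v"
      by (simp add: B_def poly_sum poly_monom X_def power_mult_distrib fps_const_power mult.commute)
    finally show ?thesis .
  qed
  then show ?thesis
    using that deg lead by blast
qed

text \<open>The image \<open>U\<close> of \<open>k\<close> is simply connected, so it contains no circle around \<open>0\<close> of radius greater
  than \<open>\<bar>w\<bar>\<close>: such a circle winds once around the omitted value \<open>w\<close>. The reciprocals \<open>K\<close> of the omitted
  values, with \<open>1 / \<infinity> = 0\<close> among them, thus meet every circle of radius at most \<open>L = 1 / \<bar>w\<bar>\<close>. The polynomials from
  \<open>taylor_coeff_resolvent\<close> are bounded by \<open>C / \<rho>\<^sup>n\<close> on \<open>K\<close> for each \<open>\<rho> < 1\<close>, and they
  reach at least \<open>(\<bar>k'(0)\<bar> L / 4)\<^sup>n\<close> there. Letting \<open>n\<close> grow gives \<open>\<bar>k'(0)\<bar> L / 4 \<le> 1 / \<rho>\<close>.\<close>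

theorem koebe_quarter:
  fixes k :: "complex \<Rightarrow> complex"
  assumes hol: "k holomorphic_on ball 0 1" and inj: "inj_on k (ball 0 1)" and k0: "k 0 = 0"
    and w: "w \<notin> k ` ball 0 1"
  shows "cmod (deriv k 0) \<le> 4 * cmod w"
proof (rule ccontr)
  assume neg: "\<not> ?thesis"
  define c where "c = deriv k 0"
  define U where "U = k ` ball 0 1"
  have openU: "open U"
    unfolding U_def by (rule open_mapping_thm3[OF hol _ inj]) auto
  have "0 \<in> U"
    unfolding U_def using k0 by (auto simp: image_iff intro!: bexI[of _ 0])
  then have w0: "w \<noteq> 0"
    using w unfolding U_def by auto
  have c0: "c \<noteq> 0"
    unfolding c_def by (rule holomorphic_injective_imp_regular[OF hol _ inj]) auto
  have "ball (0::complex) 1 homeomorphic U"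
    unfolding U_def
    using invariance_of_domain_homeomorphic[OF _ holomorphic_on_imp_continuous_on[OF hol] _ inj]
    by auto
  then have scU: "simply_connected U"
    using homeomorphic_simply_connected convex_imp_simply_connected[OF convex_ball] by blast
  define L where "L = 1 / cmod w"
  have L0: "L > 0" using w0 by (simp add: L_def)
  have cL: "cmod c * L / 4 > 1"
    using neg w0 by (simp add: L_def c_def field_simps)
  define K where "K = {v. \<forall>z\<in>ball 0 1. v * k z \<noteq> 1}"
  have K_iff: "v \<in> K \<longleftrightarrow> 1 / v \<notin> U" if "v \<noteq> 0" for v
    using that by (auto simp: K_def U_def field_simps)
  have Kt: "\<exists>v\<in>K. cmod v = t" if t: "0 \<le> t" "t \<le> L" for t
  proof -
    consider "t = 0" | "t = L" | "0 < t" "t < L" using t by linarith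
    then show ?thesis
    proof cases
      case 1
      then show ?thesis by (intro bexI[of _ 0]) (auto simp: K_def)
    next
      case 2
      then show ?thesis
        using w w0 by (intro bexI[of _ "1/w"]) (auto simp: K_iff U_def L_def norm_divide)
    next
      case 3
      have "\<not> path_image (circlepath 0 (1/t)) \<subseteq> U"
      proof
        assume sub: "path_image (circlepath 0 (1/t)) \<subseteq> U"
        have "winding_number (circlepath 0 (1/t)) w = 0"
          using w by (intro simply_connected_imp_winding_number_zero[OF scU _ sub]) (auto simp: U_def)
        moreover have "cmod w < 1/t"
          using 3 w0 by (simp add: L_def field_simps)
        then have "winding_number (circlepath 0 (1/t)) w = 1"
          by (intro winding_number_circlepath) simp
        ultimately show False by simp
      qed
      then obtain s where s: "cmod s = 1/t" "s \<notin> U"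
        using 3 by (auto simp: subset_iff)
      moreover from this have "s \<noteq> 0"
        using 3 by auto
      ultimately have "1/s \<in> K" "cmod (1/s) = t"
        using 3 by (auto simp: K_iff norm_divide)
      then show ?thesis by blast
    qed
  qed
  obtain \<rho> where \<rho>: "0 < \<rho>" "\<rho> < 1" "cmod c * L / 4 * \<rho> > 1"
  proof -
    define a where "a = cmod c * L / 4"
    have "1 / a < 1" "0 < 1 / a" using cL by (auto simp: a_def[symmetric])
    then obtain \<rho> where "1 / a < \<rho>" "\<rho> < 1" using dense by blast
    moreover from this have "\<rho> > 0"
      using \<open>0 < 1 / a\<close> by linarith
    moreover from \<open>1 / a < \<rho>\<close> have "a * \<rho> > 1"
      using cL by (simp add: a_def field_simps)
    ultimately show ?thesis using that a_def by blast
  qed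
  obtain C where C: "\<And>v z. v \<in> K \<Longrightarrow> cmod z = \<rho> \<Longrightarrow> cmod (inverse (1 - v * k z)) \<le> C"
  proof -
    define A where "A = k ` sphere 0 \<rho>"
    have cont: "continuous_on (sphere 0 \<rho>) k"
      by (rule continuous_on_subset[OF holomorphic_on_imp_continuous_on[OF hol]]) (use \<rho> in auto)
    have compA: "compact A"
      unfolding A_def by (rule compact_continuous_image[OF cont]) auto
    have AU: "A \<subseteq> U"
      unfolding A_def U_def using \<rho> by (intro image_mono) auto
    obtain \<delta> where \<delta>: "\<delta> > 0" "\<And>a b. a \<in> A \<Longrightarrow> b \<notin> U \<Longrightarrow> \<delta> \<le> dist a b"
      using separate_compact_closed[OF compA closed_Compl[OF openU]] AU by blast
    obtain M where M: "M > 0" "\<And>a. a \<in> A \<Longrightarrow> cmod a \<le> M"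
      using compact_imp_bounded[OF compA] bounded_pos by blast
    \<comment> \<open>For small \<open>v\<close> the product \<open>v k(z)\<close> is at most \<open>1/2\<close> in modulus; otherwise \<open>\<bar>v\<bar>\<close> is at least
      \<open>1 / (2 M)\<close>, and \<open>1 / v\<close> keeps the distance \<open>\<delta>\<close> from \<open>k(z)\<close>.\<close>
    define m where "m = min (1/2) (\<delta> / (2 * M))"
    have m0: "m > 0" using \<delta> M by (simp add: m_def)
    have "cmod (inverse (1 - v * k z)) \<le> 1 / m" if v: "v \<in> K" and z: "cmod z = \<rho>" for v z
    proof -
      have kz: "k z \<in> A" using z by (auto simp: A_def)
      have "m \<le> cmod (1 - v * k z)"
      proof (cases "cmod v \<le> 1 / (2 * M)")
        case True
        have "cmod (v * k z) \<le> 1 / (2 * M) * M"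
          unfolding norm_mult using True M(2)[OF kz] M(1) by (intro mult_mono) auto
        also have "\<dots> = 1/2" using M(1) by simp
        finally have "1/2 \<le> cmod (1 - v * k z)"
          using norm_triangle_ineq2[of 1 "v * k z"] by simp
        then show ?thesis by (simp add: m_def)
      next
        case False
        then have v0: "v \<noteq> 0" using M by auto
        then have "\<delta> \<le> dist (k z) (1/v)"
          using \<delta>(2)[OF kz] K_iff v by blast
        then have "1 / (2 * M) * \<delta> \<le> cmod v * cmod (1/v - k z)"
          using False M \<delta>(1) by (intro mult_mono) (auto simp: dist_norm norm_minus_commute)
        also have "\<dots> = cmod (1 - v * k z)"
          unfolding norm_mult[symmetric] using v0 by (simp add: right_diff_distrib)
        finally show ?thesis by (simp add: m_def)
      qed
      then show ?thesis
        using m0 by (simp add: norm_inverse divide_inverse le_imp_inverse_le)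
    qed
    then show ?thesis using that by blast
  qed
  have bound: "(cmod c * L / 4 * \<rho>) ^ n \<le> C" for n
  proof -
    have an: "k analytic_on {0}"
      using hol by (meson analytic_at centre_in_ball open_ball zero_less_one)
    obtain B where B: "degree B = n" "lead_coeff B = c ^ n"
      "\<And>v. (deriv ^^ n) (\<lambda>z. inverse (1 - v * k z)) 0 = fact n * poly B v"
      using taylor_coeff_resolvent[OF an k0, of n] c0 unfolding c_def by metis
    obtain v where v: "v \<in> K" "cmod (c ^ n) * (L/4) ^ n \<le> cmod (poly B v)"
      using poly_large_on_radial_set[of L K B] Kt L0 B by auto
    have hol': "(\<lambda>z. inverse (1 - v * k z)) holomorphic_on ball 0 1"
      using v(1) by (intro holomorphic_intros hol) (auto simp: K_def)
    have "cmod ((deriv ^^ n) (\<lambda>z. inverse (1 - v * k z)) 0) \<le> fact n * C / \<rho> ^ n"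
    proof (rule Cauchy_inequality)
      show "(\<lambda>z. inverse (1 - v * k z)) holomorphic_on ball 0 \<rho>"
        by (rule holomorphic_on_subset[OF hol']) (use \<rho> in auto)
      show "continuous_on (cball 0 \<rho>) (\<lambda>z. inverse (1 - v * k z))"
        by (rule holomorphic_on_imp_continuous_on[OF holomorphic_on_subset[OF hol']]) (use \<rho> in auto)
    qed (use \<rho> C v in auto)
    then have "cmod (poly B v) \<le> C / \<rho> ^ n"
      unfolding B(3) by (simp add: norm_mult mult_le_cancel_left_pos flip: times_divide_eq_right)
    with v(2) have "cmod c ^ n * (L/4) ^ n \<le> C / \<rho> ^ n"
      by (simp add: norm_power)
    then have "cmod c ^ n * (L/4) ^ n * \<rho> ^ n \<le> C"
      using \<rho>(1) by (simp add: pos_le_divide_eq)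
    then show ?thesis
      by (simp add: power_mult_distrib power_divide)
  qed
  show False
    using real_arch_pow[OF \<rho>(3), of C] bound by (meson not_le)
qed

section \<open>The exterior of a convex set and its Riemann map\<close>

text \<open>The complement of \<open>E\<close> in the sphere, in the coordinate \<open>u = 1 / (y - e)\<close>; for \<open>e \<in> E\<close> this
  places the whole complement, \<open>y = \<infinity>\<close> included, in the finite plane.\<close>

definition inverted_exterior :: "complex set \<Rightarrow> complex \<Rightarrow> complex set" where
  "inverted_exterior E e = {u. u = 0 \<or> e + 1 / u \<notin> E}"

lemma open_inverted_exterior:
  assumes "compact E"
  shows "open (inverted_exterior E e)"
proof -
  have "compact ((\<lambda>y. y - e) ` E)"
    by (intro compact_continuous_image continuous_intros assms)
  then obtain M where M: "M > 0" "\<And>y. y \<in> (\<lambda>y. y - e) ` E \<Longrightarrow> cmod y \<le> M"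
    using compact_imp_bounded bounded_pos by metis
  have "open ((-{0}) \<inter> (\<lambda>u. e + 1 / u) -` (-E))"
    by (intro continuous_open_preimage continuous_intros open_Compl compact_imp_closed assms) auto
  moreover have "inverted_exterior E e = ball 0 (1/M) \<union> ((-{0}) \<inter> (\<lambda>u. e + 1 / u) -` (-E))"
  proof -
    have "e + 1 / u \<notin> E" if "u \<noteq> 0" "cmod u < 1 / M" for u
    proof
      assume "e + 1 / u \<in> E"
      then have "cmod (1 / u) \<le> M"
        by (intro M(2) image_eqI[of _ _ "e + 1 / u"]) auto
      then show False
        using that M(1) by (simp add: norm_divide field_simps)
    qed
    then show ?thesis
      using M(1) by (auto simp: inverted_exterior_def)
  qed
  ultimately show ?thesis by (metis open_Un open_ball)
qed

text \<open>Convexity of \<open>E\<close> makes the inverted exterior starlike about \<open>0\<close>: the segment from \<open>0\<close> to \<open>u\<close>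
  corresponds to the ray that leaves \<open>e + 1 / u\<close> in the direction away from \<open>e\<close>.\<close>

lemma simply_connected_inverted_exterior:
  assumes "convex E" "e \<in> E"
  shows "simply_connected (inverted_exterior E e)"
proof (rule starlike_imp_simply_connected)
  have "t *\<^sub>R u \<in> inverted_exterior E e" if u: "u \<in> inverted_exterior E e" and t: "0 \<le> t" "t \<le> 1" for u t
  proof (cases "t = 0 \<or> u = 0")
    case False
    have "e + 1 / u \<in> E" if "e + 1 / (t *\<^sub>R u) \<in> E"
    proof -
      have "(1 - t) *\<^sub>R e + t *\<^sub>R (e + 1 / (t *\<^sub>R u)) \<in> E"
        using t that by (intro convexD[OF assms(1) assms(2)]) auto
      also have "(1 - t) *\<^sub>R e + t *\<^sub>R (e + 1 / (t *\<^sub>R u)) = e + 1 / u"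
        using False by (simp add: scaleR_conv_of_real field_simps)
      finally show ?thesis .
    qed
    then show ?thesis using u False by (auto simp: inverted_exterior_def)
  qed (auto simp: inverted_exterior_def)
  then have "closed_segment 0 u \<subseteq> inverted_exterior E e" if "u \<in> inverted_exterior E e" for u
    using that by (auto simp: in_segment)
  then show "starlike (inverted_exterior E e)"
    unfolding starlike_def by (intro bexI[of _ 0]) (auto simp: inverted_exterior_def)
qed

text \<open>In terms of the coordinate \<open>y = e + 1 / f(z)\<close>, the function
  \<open>H(z) = z (y(z) - y(-z))\<close> is holomorphic on the disc with \<open>H(0) = 2 / f'(0)\<close>. Near the unit circle
  \<open>y(z)\<close> and \<open>y(-z)\<close> are both close to \<open>E\<close>, so \<open>\<bar>H\<bar>\<close> is at most \<open>d + \<epsilon>\<close> there, and the maximum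
  principle transfers this bound to \<open>H(0)\<close>.\<close>

theorem exterior_riemann_map:
  assumes E: "compact E" "convex E" "e \<in> E" "E \<noteq> {e}"
    and diam: "\<And>x y. x \<in> E \<Longrightarrow> y \<in> E \<Longrightarrow> cmod (x - y) \<le> d"
  obtains f where "f holomorphic_on ball 0 1" "inj_on f (ball 0 1)" "f 0 = 0"
    "f ` ball 0 1 = inverted_exterior E e" "2 \<le> d * cmod (deriv f 0)"
proof -
  define S where "S = inverted_exterior E e"
  have S0: "0 \<in> S" by (simp add: S_def inverted_exterior_def)
  have opS: "open S" unfolding S_def by (rule open_inverted_exterior[OF E(1)])
  have "S \<noteq> UNIV"
  proof -
    obtain y where "y \<in> E" "y \<noteq> e" using E by blast
    then have "1 / (y - e) \<notin> S" by (simp add: S_def inverted_exterior_def)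
    then show ?thesis by blast
  qed
  then obtain h0 f0 where hf0: "h0 holomorphic_on S" "f0 holomorphic_on ball 0 1"
      "\<And>z. z \<in> S \<Longrightarrow> h0 z \<in> ball 0 1 \<and> f0 (h0 z) = z"
      "\<And>z. z \<in> ball 0 1 \<Longrightarrow> f0 z \<in> S \<and> h0 (f0 z) = z"
    using Riemann_mapping_theorem[of S] simply_connected_inverted_exterior[OF E(2,3)] opS S0
    unfolding S_def by blast
  have "h0 0 \<in> ball 0 1" using hf0(3) S0 by blast
  then obtain m m' where m: "m (h0 0) = 0" "m holomorphic_on ball 0 1" "m ` ball 0 1 \<subseteq> ball 0 1"
      "m' holomorphic_on ball 0 1" "m' ` ball 0 1 \<subseteq> ball 0 1"
      "\<And>z. z \<in> ball 0 1 \<Longrightarrow> m (m' z) = z" "\<And>z. z \<in> ball 0 1 \<Longrightarrow> m' (m z) = z"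
    using ball_biholomorphism_exists by (metis order_refl)
  define f where "f = f0 \<circ> m'"
  define h where "h = m \<circ> h0"
  have holf: "f holomorphic_on ball 0 1"
    unfolding f_def using m(5) by (intro holomorphic_on_compose_gen[OF m(4) hf0(2)]) auto
  have holh: "h holomorphic_on S"
    unfolding h_def using hf0(3) by (intro holomorphic_on_compose_gen[OF hf0(1) m(2)]) auto
  have fS: "f z \<in> S" and hf: "h (f z) = z" if "z \<in> ball 0 1" for z
    using that m(5,6) hf0(4) by (auto simp: f_def h_def image_subset_iff)
  have hD: "h u \<in> ball 0 1" and fh: "f (h u) = u" if "u \<in> S" for u
    using that m(3,7) hf0(3) by (auto simp: f_def h_def image_subset_iff)
  have f0: "f 0 = 0"
    using fh[OF S0] m(1) by (simp add: h_def)
  have injf: "inj_on f (ball 0 1)"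
    using hf by (rule inj_on_inverseI)
  have imf: "f ` ball 0 1 = S"
    using fS fh hD by (metis image_subsetI subsetI subset_antisym image_eqI)
  have f'0: "deriv f 0 \<noteq> 0"
    by (rule holomorphic_injective_imp_regular[OF holf _ injf]) auto
  \<comment> \<open>Writing \<open>f(z) = z \<phi>(z)\<close> exhibits \<open>H\<close> as holomorphic at \<open>0\<close> too.\<close>
  define \<phi> where "\<phi> = (\<lambda>z. if z = 0 then deriv f 0 else f z / z)"
  have hol\<phi>: "\<phi> holomorphic_on ball 0 1"
    using pole_lemma_open[OF holf, of 0] by (simp add: \<phi>_def f0 cong: if_cong)
  have \<phi>0: "\<phi> z \<noteq> 0" if "z \<in> ball 0 1" for z
    using f'0 injf f0 that by (auto simp: \<phi>_def inj_on_def)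
  define H where "H = (\<lambda>z. 1 / \<phi> z + 1 / \<phi> (- z))"
  have holH: "H holomorphic_on ball 0 1"
  proof -
    have "(\<phi> \<circ> uminus) holomorphic_on ball 0 1"
      by (rule holomorphic_on_compose_gen[OF _ hol\<phi>]) (auto intro!: holomorphic_intros)
    then have "(\<lambda>z. \<phi> (- z)) holomorphic_on ball 0 1" by (simp add: o_def)
    then show ?thesis
      unfolding H_def using \<phi>0 by (intro holomorphic_intros hol\<phi>) auto
  qed
  have H_eq: "H z = z * ((e + 1 / f z) - (e + 1 / f (- z)))" if "z \<noteq> 0" for z
    using that by (simp add: H_def \<phi>_def algebra_simps)
  have "2 / cmod (deriv f 0) \<le> d + \<epsilon>" if "\<epsilon> > 0" for \<epsilon>
  proof -
    \<comment> \<open>The points of the exterior at distance at least \<open>\<epsilon>/2\<close> from \<open>E\<close> form a compact set, whose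
      preimage in the disc stays away from the unit circle.\<close>
    define Q where "Q = {u. u = 0 \<or> \<epsilon>/2 \<le> infdist (e + 1 / u) E}"
    have QS: "Q \<subseteq> S"
      using that by (auto simp: Q_def S_def inverted_exterior_def)
    have "open ((-{0}) \<inter> (\<lambda>u. infdist (e + 1 / u) E) -` {..<\<epsilon>/2})"
      by (intro continuous_open_preimage continuous_intros) auto
    moreover have "- Q = (-{0}) \<inter> (\<lambda>u. infdist (e + 1 / u) E) -` {..<\<epsilon>/2}"
      by (auto simp: Q_def not_le)
    ultimately have "closed Q" by (simp add: closed_def)
    moreover have "bounded Q"
    proof (rule boundedI)
      fix u assume "u \<in> Q"
      then consider "u = 0" | "u \<noteq> 0" "\<epsilon>/2 \<le> infdist (e + 1 / u) E" by (auto simp: Q_def)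
      then show "cmod u \<le> 2 / \<epsilon>"
      proof cases
        case 2
        have "infdist (e + 1 / u) E \<le> dist (e + 1 / u) e"
          by (rule infdist_le[OF E(3)])
        then have "\<epsilon>/2 \<le> 1 / cmod u"
          using 2 by (simp add: dist_norm norm_divide)
        then show ?thesis using 2 that by (simp add: field_simps)
      qed (use that in auto)
    qed
    ultimately have "compact Q" by (simp add: compact_eq_bounded_closed)
    then have "compact (h ` Q)"
      by (intro compact_continuous_image holomorphic_on_imp_continuous_on holomorphic_on_subset[OF holh QS])
    moreover have "0 \<in> Q" by (simp add: Q_def)
    ultimately obtain q where q: "q \<in> Q" "\<And>u. u \<in> Q \<Longrightarrow> cmod (h u) \<le> cmod (h q)"
      using continuous_attains_sup[of "h ` Q" cmod] by (auto intro!: continuous_intros)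
    then have "cmod (h q) < 1" using hD QS by auto
    then obtain r where r: "cmod (h q) < r" "r < 1" using dense by blast
    have r0: "r > 0" using r(1) norm_ge_zero[of "h q"] by linarith
    have near: "\<exists>y\<in>E. cmod (e + 1 / f z - y) < \<epsilon>/2" if z: "cmod z = r" for z
    proof -
      have zD: "z \<in> ball 0 1" using z r by simp
      have "f z \<notin> Q"
        using q(2)[of "f z"] hf[OF zD] z r(1) by auto
      then have "infdist (e + 1 / f z) E < \<epsilon>/2"
        by (auto simp: Q_def)
      then show ?thesis
        using infdist_attains_inf[OF compact_imp_closed[OF E(1)], of "e + 1 / f z"] E(3)
        by (metis dist_norm empty_iff)
    qed
    have "cmod (H 0) \<le> r * (d + \<epsilon>)"
    proof (rule maximum_modulus_frontier[of H "cball 0 r"])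
      show "H holomorphic_on interior (cball 0 r)"
        by (rule holomorphic_on_subset[OF holH]) (use r in auto)
      show "continuous_on (closure (cball 0 r)) H"
        by (rule holomorphic_on_imp_continuous_on[OF holomorphic_on_subset[OF holH]]) (use r in auto)
    next
      fix z :: complex assume "z \<in> frontier (cball 0 r)"
      then have z: "cmod z = r" by auto
      obtain y1 y2 where y: "y1 \<in> E" "cmod (e + 1 / f z - y1) < \<epsilon>/2"
          "y2 \<in> E" "cmod (e + 1 / f (- z) - y2) < \<epsilon>/2"
        using near[of z] near[of "-z"] z by auto
      have "(e + 1 / f z) - (e + 1 / f (- z)) = (e + 1 / f z - y1) + (y1 - y2) - (e + 1 / f (- z) - y2)"
        by simp
      then have "cmod ((e + 1 / f z) - (e + 1 / f (- z))) \<le> d + \<epsilon>"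
        using y diam[OF y(1,3)] norm_triangle_ineq4[of "(e + 1 / f z - y1) + (y1 - y2)" "e + 1 / f (- z) - y2"]
          norm_triangle_ineq[of "e + 1 / f z - y1" "y1 - y2"] by simp
      then have "r * cmod ((e + 1 / f z) - (e + 1 / f (- z))) \<le> r * (d + \<epsilon>)"
        using r0 by (intro mult_left_mono) auto
      moreover have "z \<noteq> 0" using z r0 by auto
      ultimately show "cmod (H z) \<le> r * (d + \<epsilon>)"
        using z by (metis H_eq norm_mult)
    qed (use r0 in auto)
    moreover have "r * (d + \<epsilon>) \<le> 1 * (d + \<epsilon>)"
      using r diam[OF E(3,3)] that by (intro mult_right_mono) auto
    moreover have "cmod (H 0) = 2 / cmod (deriv f 0)"
      by (simp add: H_def \<phi>_def norm_divide flip: add_divide_distrib)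
    ultimately show ?thesis by simp
  qed
  then have "2 / cmod (deriv f 0) \<le> d"
    by (rule field_le_epsilon)
  then have "2 \<le> d * cmod (deriv f 0)"
    using f'0 by (simp add: field_simps)
  then show ?thesis
    using that holf injf f0 imf S_def by blast
qed

section \<open>Quotients of polynomials as covering maps\<close>

lemma card_roots_rsquarefree:
  fixes p :: "complex poly"
  assumes "rsquarefree p"
  shows "card {z. poly p z = 0} = degree p"
proof -
  have "p \<noteq> 0" using assms by (simp add: rsquarefree_def)
  then have "degree p = (\<Sum>z | poly p z = 0. order z p)"
    by (rule degree_eq_sum_order)
  also have "\<dots> = (\<Sum>z | poly p z = 0. 1)"
    using assms \<open>p \<noteq> 0\<close> by (intro sum.cong) (auto simp: rsquarefree_root_order)
  finally show ?thesis by simp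
qed

text \<open>For a regular value \<open>v\<close> the polynomial \<open>P - v Q\<close> has exactly \<open>deg P\<close> distinct roots; as
  \<open>deg Q < deg P\<close>, no preimage of \<open>v\<close> lies at \<open>\<infinity>\<close>. Choose disjoint discs around the roots on which \<open>P / Q\<close> is injective.
  Every value \<open>v'\<close> near \<open>v\<close> has one preimage in each disc, and since it also has exactly \<open>deg P\<close>
  preimages, there are no others: \<open>v\<close> has an evenly covered neighbourhood.\<close>

theorem covering_space_poly_quotient:
  fixes P Q :: "complex poly"
  assumes cop: "coprime P Q" and deg: "degree Q < degree P" and "open S"
    and C: "C = {s. poly Q s \<noteq> 0 \<and> poly P s / poly Q s \<in> S}"
    and regular: "\<And>s. s \<in> C \<Longrightarrow> poly (wronskian P Q) s \<noteq> 0"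
  shows "open C" "(\<lambda>s. poly P s / poly Q s) holomorphic_on C"
    "covering_space C (\<lambda>s. poly P s / poly Q s) S"
proof -
  define T where "T = (\<lambda>s. poly P s / poly Q s)"
  have "open ({s. poly Q s \<noteq> 0} \<inter> T -` S)"
    unfolding T_def
    by (intro continuous_open_preimage continuous_intros \<open>open S\<close> open_Collect_neq) auto
  also have "{s. poly Q s \<noteq> 0} \<inter> T -` S = C"
    by (auto simp: C T_def)
  finally show opC: "open C" .
  have holT: "T holomorphic_on C"
    unfolding T_def C by (intro holomorphic_intros) auto
  then show "(\<lambda>s. poly P s / poly Q s) holomorphic_on C"
    by (simp add: T_def)
  have derivT: "deriv T s \<noteq> 0" if "s \<in> C" for s
    using DERIV_imp_deriv[OF has_field_derivative_poly_quotient[of Q s P]] regular[OF that] that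
    by (simp add: T_def C)
  have contT: "continuous_on A T" if "A \<subseteq> C" for A
    by (rule continuous_on_subset[OF holomorphic_on_imp_continuous_on[OF holT] that])
  define Z where "Z = (\<lambda>v. {s. poly (P - smult v Q) s = 0})"
  have Z_iff: "s \<in> Z v \<longleftrightarrow> poly Q s \<noteq> 0 \<and> T s = v" for s v
    using cop by (auto simp: Z_def T_def coprime_complex_poly_iff field_simps)
  have cardZ: "card (Z v) = degree P" and finZ: "finite (Z v)" if v: "v \<in> S" for v
  proof -
    have degv: "degree (P - smult v Q) = degree P"
      using deg degree_smult_le[of v Q]
      by (subst diff_conv_add_uminus, subst degree_add_eq_left) auto
    have "rsquarefree (P - smult v Q)"
      unfolding rsquarefree_roots
    proof (intro allI notI, elim conjE)
      fix s assume s: "poly (P - smult v Q) s = 0" "poly (pderiv (P - smult v Q)) s = 0"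
      then have "s \<in> C"
        using Z_iff[of s v] v by (auto simp: C Z_def T_def)
      moreover have "poly (wronskian p Q) s = 0" if "poly p s = 0" "poly (pderiv p) s = 0" for p
        using that by (simp add: wronskian_def)
      with s have "poly (wronskian (P - smult v Q) Q) s = 0"
        by blast
      ultimately show False
        using regular by (simp add: wronskian_diff_smult)
    qed
    then show "card (Z v) = degree P"
      unfolding Z_def using card_roots_rsquarefree degv by metis
    then show "finite (Z v)"
      using deg by (intro card_ge_0_finite) simp
  qed
  have "covering_space C T S"
  proof
    show "continuous_on C T" by (rule contT) simp
    show "T ` C = S"
    proof
      show "T ` C \<subseteq> S" by (auto simp: C T_def)
      show "S \<subseteq> T ` C"
      proof
        fix v assume v: "v \<in> S"
        then have "Z v \<noteq> {}" using cardZ[OF v] deg by auto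
        then obtain s where "s \<in> Z v" by blast
        then show "v \<in> T ` C" using v by (auto simp: Z_iff C T_def)
      qed
    qed
    fix v assume v: "v \<in> S"
    have ZC: "Z v \<subseteq> C" using v by (auto simp: Z_iff C T_def)
    have "\<exists>r>0. ball s r \<subseteq> C \<and> inj_on T (ball s r) \<and> (\<forall>s'\<in>Z v. s' \<noteq> s \<longrightarrow> 2 * r \<le> dist s s')"
      if s: "s \<in> Z v" for s
    proof -
      obtain r1 where r1: "r1 > 0" "ball s r1 \<subseteq> C" "inj_on T (ball s r1)"
        using has_complex_derivative_locally_injective[OF holT _ opC] derivT s ZC by blast
      obtain r2 where r2: "r2 > 0" "\<And>s'. s' \<in> Z v \<Longrightarrow> s' \<noteq> s \<Longrightarrow> r2 \<le> dist s s'"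
        using finite_set_avoid[OF finZ[OF v], of s] by blast
      have sub: "ball s (min r1 (r2/2)) \<subseteq> ball s r1" by auto
      show ?thesis
        using r1 r2 sub inj_on_subset[OF r1(3) sub]
        by (intro exI[of _ "min r1 (r2/2)"]) force
    qed
    then obtain r where r: "\<And>s. s \<in> Z v \<Longrightarrow> r s > 0" "\<And>s. s \<in> Z v \<Longrightarrow> ball s (r s) \<subseteq> C"
        "\<And>s. s \<in> Z v \<Longrightarrow> inj_on T (ball s (r s))"
        "\<And>s s'. s \<in> Z v \<Longrightarrow> s' \<in> Z v \<Longrightarrow> s' \<noteq> s \<Longrightarrow> 2 * r s \<le> dist s s'"
      by metis
    have disj: "s = s'" if "s \<in> Z v" "s' \<in> Z v" "y \<in> ball s (r s)" "y \<in> ball s' (r s')" for s s' y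
    proof (rule ccontr)
      assume "s \<noteq> s'"
      then have "2 * r s \<le> dist s s'" "2 * r s' \<le> dist s s'"
        using r(4)[of s s'] r(4)[of s' s] that by (auto simp: dist_commute)
      moreover have "dist s s' < r s + r s'"
        using that dist_triangle2[of s s' y] by (auto simp: dist_commute)
      ultimately show False by linarith
    qed
    define t where "t = S \<inter> (\<Inter>s\<in>Z v. T ` ball s (r s))"
    define u where "u = (\<lambda>s. ball s (r s) \<inter> T -` t)"
    have opT: "open (T ` ball s (r s))" if "s \<in> Z v" for s
      by (rule open_mapping_thm3[OF holomorphic_on_subset[OF holT r(2)[OF that]] _ r(3)[OF that]]) simp
    have opt: "open t"
      unfolding t_def using opT by (intro open_Int \<open>open S\<close> open_INT finZ[OF v]) auto
    have "v \<in> t"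
      unfolding t_def using v r(1) by (auto simp: Z_iff intro!: image_eqI[of v T])
    have opu: "open (u s)" if "s \<in> Z v" for s
      unfolding u_def by (intro continuous_open_preimage contT r(2) that opt) auto
    have Union: "\<Union>(u ` Z v) = C \<inter> T -` t"
    proof
      show "\<Union>(u ` Z v) \<subseteq> C \<inter> T -` t" using r(2) by (fastforce simp: u_def)
      show "C \<inter> T -` t \<subseteq> \<Union>(u ` Z v)"
      proof
        fix y assume y: "y \<in> C \<inter> T -` t"
        define v' where "v' = T y"
        have v': "v' \<in> t" "v' \<in> S" using y by (auto simp: v'_def t_def)
        have "\<forall>s\<in>Z v. \<exists>x\<in>ball s (r s). T x = v'"
          using v'(1) unfolding t_def by blast
        then obtain g where g: "\<And>s. s \<in> Z v \<Longrightarrow> g s \<in> ball s (r s)" "\<And>s. s \<in> Z v \<Longrightarrow> T (g s) = v'"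
          by metis
        have "inj_on g (Z v)"
          using g(1) disj by (metis inj_onI)
        then have "card (g ` Z v) = card (Z v')"
          using cardZ v v' by (simp add: card_image)
        moreover have "g ` Z v \<subseteq> Z v'"
          using g r(2) by (fastforce simp: Z_iff C)
        ultimately have "g ` Z v = Z v'"
          using finZ[OF v'(2)] by (simp add: card_subset_eq)
        moreover have "y \<in> Z v'" using y by (auto simp: Z_iff v'_def C)
        ultimately obtain s where "s \<in> Z v" "y = g s" by blast
        then show "y \<in> \<Union>(u ` Z v)" using g v' by (auto simp: u_def)
      qed
    qed
    have hom: "\<exists>q. homeomorphism (u s) t T q" if s: "s \<in> Z v" for s
    proof -
      have sub: "u s \<subseteq> ball s (r s)" by (auto simp: u_def)
      have "T ` u s = t"
      proof
        show "T ` u s \<subseteq> t" by (auto simp: u_def)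
        show "t \<subseteq> T ` u s"
        proof
          fix y assume y: "y \<in> t"
          then obtain x where "x \<in> ball s (r s)" "y = T x"
            using s by (auto simp: t_def)
          then show "y \<in> T ` u s" using y by (auto simp: u_def)
        qed
      qed
      moreover obtain q where "homeomorphism (u s) (T ` u s) T q"
        using invariance_of_domain_homeomorphism[OF opu[OF s] contT[OF order_trans[OF sub r(2)[OF s]]] _
            inj_on_subset[OF r(3)[OF s] sub]] by auto
      ultimately show ?thesis by auto
    qed
    have "pairwise disjnt (u ` Z v)"
      using disj by (auto simp: pairwise_def disjnt_iff u_def)
    then have "\<exists>V. \<Union>V = C \<inter> T -` t \<and> (\<forall>w\<in>V. openin (top_of_set C) w) \<and> pairwise disjnt V \<and>
        (\<forall>w\<in>V. \<exists>q. homeomorphism w t T q)"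
      using Union opu hom r(2) opC
      by (intro exI[of _ "u ` Z v"]) (auto simp: openin_open_eq u_def)
    moreover have "openin (top_of_set S) t"
      using opt \<open>open S\<close> by (simp add: openin_open_eq t_def)
    ultimately show "\<exists>t. v \<in> t \<and> openin (top_of_set S) t \<and>
        (\<exists>V. \<Union>V = C \<inter> T -` t \<and> (\<forall>w\<in>V. openin (top_of_set C) w) \<and> pairwise disjnt V \<and>
        (\<forall>w\<in>V. \<exists>q. homeomorphism w t T q))"
      using \<open>v \<in> t\<close> by blast
  qed
  then show "covering_space C (\<lambda>s. poly P s / poly Q s) S"
    by (simp add: T_def)
qed

section \<open>A pair of critical points with well separated critical values\<close>

text \<open>The critical point \<open>a\<close> is moved to \<open>\<infinity>\<close> by \<open>z = a + 1 / s\<close>, and its critical value \<open>e\<close> by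
  \<open>u = 1 / (y - e)\<close>. In these coordinates \<open>p / q\<close> becomes the map \<open>T\<close>, which fixes \<open>0\<close> and has
  \<open>T'(0) = 1 / L\<close> for the ratio \<open>L\<close> of the leading coefficients of \<open>p\<close> and \<open>q\<close>. The Riemann map \<open>f\<close> of the
  exterior of the convex hull \<open>E\<close> of the critical values lifts through \<open>T\<close> to a map
  \<open>k\<close> with \<open>T \<circ> k = f\<close>; it is injective because \<open>f\<close> is, and it omits \<open>1 / (b - a)\<close> because \<open>T\<close> has no
  critical points over the exterior. Combining \<open>2 \<le> d \<bar>f'(0)\<bar>\<close>, \<open>f'(0) = T'(0) k'(0)\<close> and
  \<open>\<bar>k'(0)\<bar> \<le> 4 / \<bar>b - a\<bar>\<close> gives the inequality.\<close>

theorem critical_pair_normalised: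
  fixes p q :: "complex poly"
  assumes cop: "coprime p q" and n: "degree p = n" "degree q = n - 1" "n \<ge> 2"
    and simple_poles: "\<And>z. poly q z = 0 \<Longrightarrow> poly (pderiv q) z \<noteq> 0"
  obtains a b where "poly (wronskian p q) a = 0" "poly (wronskian p q) b = 0"
    "poly q a \<noteq> 0" "poly q b \<noteq> 0" "poly p a / poly q a \<noteq> poly p b / poly q b"
    "cmod (lead_coeff p) * cmod (a - b)
      \<le> 2 * cmod (lead_coeff q) * cmod (poly p a / poly q a - poly p b / poly q b)"
proof -
  define R where "R = (\<lambda>z. poly p z / poly q z)"
  define Crit where "Crit = {z. poly (wronskian p q) z = 0}"
  have q_Crit: "poly q z \<noteq> 0" if "z \<in> Crit" for z
    using that simple_poles[of z] cop by (auto simp: Crit_def wronskian_def coprime_complex_poly_iff)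
  have nz: "p \<noteq> 0" "q \<noteq> 0" using n by auto
  then have lc: "lead_coeff p \<noteq> 0" "lead_coeff q \<noteq> 0" by auto
  have another: "\<exists>z\<in>Crit. R z \<noteq> v" for v
    using critical_value_not_unique[OF cop n, of v] q_Crit
    by (auto simp: Crit_def R_def field_simps)
  have "wronskian p q \<noteq> 0"
    using degree_wronskian_ge[OF n] n by auto
  then have "finite (R ` Crit)"
    unfolding Crit_def by (intro finite_imageI poly_roots_finite)
  moreover have "R ` Crit \<noteq> {}" using another by blast
  ultimately obtain a b where ab: "a \<in> Crit" "b \<in> Crit"
    and extremal: "\<And>x y. x \<in> convex hull (R ` Crit) \<Longrightarrow> y \<in> convex hull (R ` Crit) \<Longrightarrow>
        cmod (x - y) \<le> cmod (R a - R b)"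
    using simplex_extremal_le[of "R ` Crit"] by (smt (verit) imageE)
  define E where "E = convex hull (R ` Crit)"
  define e where "e = R a"
  have R_E: "R z \<in> E" if "z \<in> Crit" for z
    unfolding E_def using that by (simp add: hull_inc)
  have eE: "e \<in> E" using R_E ab by (simp add: e_def)
  have neq: "R a \<noteq> R b"
  proof
    assume "R a = R b"
    then have "R z = e" if "z \<in> Crit" for z
      using extremal[of "R z" e] R_E[OF that] eE by (simp add: E_def)
    then show False using another by blast
  qed
  have "E \<noteq> {e}" using R_E[OF ab(2)] neq by (auto simp: e_def)
  moreover have "compact E" "convex E"
    using \<open>finite (R ` Crit)\<close> by (simp_all add: E_def finite_imp_compact_convex_hull convex_convex_hull)
  ultimately obtain f where f: "f holomorphic_on ball 0 1" "inj_on f (ball 0 1)" "f 0 = 0"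
      "f ` ball 0 1 = inverted_exterior E e" "2 \<le> cmod (R a - R b) * cmod (deriv f 0)"
    using exterior_riemann_map[OF _ _ eE] extremal unfolding E_def by metis

  define P where "P = reverse_at n a q"
  define Q where "Q = reverse_at n a (p - smult e q)"
  define T where "T = (\<lambda>s. poly P s / poly Q s)"
  define S where "S = inverted_exterior E e"
  define C where "C = {s. poly Q s \<noteq> 0 \<and> poly P s / poly Q s \<in> S}"
  have degq: "degree q < n" using n by simp
  then have "coeff q n = 0" by (rule coeff_eq_0)
  then have degr: "degree (p - smult e q) = n" "coeff (p - smult e q) n = lead_coeff p"
    using n degree_smult_le[of e q]
    by (subst diff_conv_add_uminus, subst degree_add_eq_left) (use n \<open>coeff q n = 0\<close> in auto)
  have degP: "degree P = n"
    using degree_reverse_at_le[of n a q] q_Crit[OF ab(1)] coeff_reverse_at_top[of n a q]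
    by (metis P_def le_antisym le_degree)
  have "coeff Q n = 0"
    using q_Crit[OF ab(1)] by (simp add: Q_def coeff_reverse_at_top e_def R_def)
  then have degQ: "degree Q < n"
    using degree_reverse_at_le[of n a "p - smult e q"] n
    by (metis Q_def degree_0 eq_zero_or_degree_less less_le_trans not_gr_zero pos2 zero_less_iff_neq_zero)
  have copPQ: "coprime P Q"
  proof -
    have "coprime q (p - smult e q)"
      using cop by (auto simp: coprime_complex_poly_iff)
    then show ?thesis
      unfolding P_def Q_def using degr degq by (intro coprime_reverse_at) auto
  qed
  have at0: "poly P 0 = 0" "poly (pderiv P) 0 = lead_coeff q" "poly Q 0 = lead_coeff p"
    using n degr degq
    by (simp_all add: P_def Q_def poly_reverse_at_0 poly_pderiv_reverse_at_0 coeff_eq_0)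
  have W0: "poly (wronskian P Q) 0 = lead_coeff q * lead_coeff p"
    by (simp add: wronskian_def at0)
  \<comment> \<open>Inverting in source and target preserves the finite critical points other than \<open>a\<close>.\<close>
  have W: "poly (wronskian P Q) s = 0 \<longleftrightarrow> a + 1 / s \<in> Crit" if "s \<noteq> 0" for s
  proof -
    have "wronskian q (p - smult e q) = - wronskian p q"
      by (simp add: wronskian_def pderiv_diff pderiv_smult algebra_simps)
    then have "s ^ 2 * poly (wronskian P Q) s = (s ^ n) ^ 2 * poly (wronskian p q) (a + 1 / s)"
      using wronskian_reverse_at[of q n "p - smult e q" s a] degr degq that by (simp add: P_def Q_def)
    then show ?thesis
      using that by (auto simp: Crit_def)
  qed
  have regular: "poly (wronskian P Q) s \<noteq> 0" if s: "s \<in> C" for s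
  proof (cases "s = 0")
    case False
    show ?thesis
    proof
      assume "poly (wronskian P Q) s = 0"
      then have z: "a + 1 / s \<in> Crit" using W False by simp
      have "poly Q s \<noteq> 0" "T s \<in> S" using s by (auto simp: C_def T_def)
      moreover have "poly P s = s ^ n * poly q (a + 1 / s)"
          "poly Q s = s ^ n * (poly p (a + 1 / s) - e * poly q (a + 1 / s))"
        using degr degq False by (simp_all add: P_def Q_def poly_reverse_at)
      ultimately have "T s \<noteq> 0" "e + 1 / T s = R (a + 1 / s)"
        using q_Crit[OF z] False by (auto simp: T_def R_def field_simps)
      then show False
        using \<open>T s \<in> S\<close> R_E[OF z] by (auto simp: S_def inverted_exterior_def)
    qed
  qed (use W0 lc in simp)
  have "open S" unfolding S_def by (rule open_inverted_exterior) fact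
  then have cov: "open C" "T holomorphic_on C" "covering_space C T S"
    unfolding T_def
    using covering_space_poly_quotient[OF copPQ _ _ C_def regular] degP degQ by auto
  have "0 \<in> C" by (simp add: C_def at0 nz S_def inverted_exterior_def)
  have fS: "f \<in> ball 0 1 \<rightarrow> S" using f(4) by (auto simp: S_def)
  obtain k where k: "continuous_on (ball 0 1) k" "k \<in> ball 0 1 \<rightarrow> C" "k 0 = 0"
      "\<And>y. y \<in> ball 0 1 \<Longrightarrow> T (k y) = f y"
  proof (rule covering_space_lift_strong[OF cov(3) \<open>0 \<in> C\<close>, of 0 "ball 0 1" f])
    show "simply_connected (ball (0::complex) 1)"
      by (simp add: convex_imp_simply_connected)
    show "locally path_connected (ball (0::complex) 1)"
      by (simp add: open_imp_locally_path_connected)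
    show "f 0 = T 0" by (simp add: f(3) T_def at0)
  qed (use fS holomorphic_on_imp_continuous_on[OF f(1)] in auto)
  have holk: "k holomorphic_on ball 0 1"
    using covering_space_lift_is_holomorphic[OF cov(3,1,2) f(1) fS k(2,1,4)] by blast
  have injk: "inj_on k (ball 0 1)"
    using f(2) k(4) by (metis inj_on_def)
  have "a \<noteq> b" using neq by auto
  have omit: "1 / (b - a) \<notin> k ` ball 0 1"
  proof
    assume "1 / (b - a) \<in> k ` ball 0 1"
    then have "1 / (b - a) \<in> C" using k(2) by auto
    then show False
      using regular[of "1 / (b - a)"] W[of "1 / (b - a)"] ab(2) \<open>a \<noteq> b\<close> by simp
  qed
  have koebe: "cmod (deriv k 0) \<le> 4 / cmod (a - b)"
    using koebe_quarter[OF holk injk k(3) omit] by (simp add: norm_divide norm_minus_commute)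
  have "deriv f 0 = lead_coeff q / lead_coeff p * deriv k 0"
  proof -
    have "(T has_field_derivative poly (wronskian P Q) 0 / poly Q 0 ^ 2) (at (k 0))"
      unfolding T_def k(3) by (rule has_field_derivative_poly_quotient) (simp add: at0 nz)
    also have "poly (wronskian P Q) 0 / poly Q 0 ^ 2 = lead_coeff q / lead_coeff p"
      using nz by (simp add: W0 at0 power2_eq_square)
    finally have "(T \<circ> k has_field_derivative lead_coeff q / lead_coeff p * deriv k 0) (at 0)"
      using holomorphic_derivI[OF holk, of 0] by (intro DERIV_chain) auto
    then have "(f has_field_derivative lead_coeff q / lead_coeff p * deriv k 0) (at 0)"
      by (rule has_field_derivative_transform_within_open[of _ _ _ "ball 0 1"]) (auto simp: k(4))
    then show ?thesis by (rule DERIV_imp_deriv)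
  qed
  then have "2 \<le> cmod (R a - R b) * (cmod (lead_coeff q) / cmod (lead_coeff p) * cmod (deriv k 0))"
    using f(5) by (simp add: norm_mult norm_divide)
  also have "\<dots> \<le> cmod (R a - R b) * (cmod (lead_coeff q) / cmod (lead_coeff p) * (4 / cmod (a - b)))"
    by (intro mult_left_mono koebe) auto
  finally have "cmod (lead_coeff p) * cmod (a - b) \<le> 2 * cmod (lead_coeff q) * cmod (R a - R b)"
    using nz \<open>a \<noteq> b\<close> by (simp add: field_simps)
  then show ?thesis
    using that ab q_Crit neq by (simp add: Crit_def R_def)
qed

section \<open>Rational maps and derivatives on the sphere\<close>

text \<open>The point with homogeneous coordinates \<open>(x, y)\<close>. Evaluating rational maps in these
  coordinates treats \<open>\<infinity>\<close> like every other point.\<close>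

definition ratio :: "complex \<Rightarrow> complex \<Rightarrow> riemann_sphere" where
  "ratio x y = (if y = 0 then None else Some (x / y))"

lemma rat_fun_Some: "rat_fun p q (Some z) = ratio (poly p z) (poly q z)"
  by (simp add: rat_fun_def ratio_def)

lemma rat_fun_None:
  "max (degree p) (degree q) = n \<Longrightarrow> rat_fun p q None = ratio (coeff p n) (coeff q n)"
  by (simp add: rat_fun_def ratio_def Let_def)

lemma moebius_ratio:
  assumes "a * d - b * c \<noteq> 0" "x \<noteq> 0 \<or> y \<noteq> 0"
  shows "rat_fun [:b, a:] [:d, c:] (ratio x y) = ratio (a * x + b * y) (c * x + d * y)"
proof (cases "y = 0")
  case True
  have "a \<noteq> 0 \<or> c \<noteq> 0" using assms(1) by auto
  then have "max (degree [:b, a:]) (degree [:d, c:]) = 1" by auto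
  then show ?thesis using True assms(2) rat_fun_None[of "[:b, a:]" "[:d, c:]" 1]
    by (simp add: ratio_def)
next
  case False
  then have "ratio (a * x + b * y) (c * x + d * y) = ratio (y * (b + x / y * a)) (y * (d + x / y * c))"
    by (simp add: algebra_simps)
  also have "\<dots> = rat_fun [:b, a:] [:d, c:] (Some (x / y))"
    using False by (simp add: ratio_def rat_fun_Some)
  finally show ?thesis
    using False by (simp add: ratio_def)
qed

lemma moebius_comp_rat_fun:
  assumes det: "a * d - b * c \<noteq> 0" and cop: "coprime p q" and n: "max (degree p) (degree q) = n"
  defines "p' \<equiv> smult a p + smult b q" and "q' \<equiv> smult c p + smult d q"
  shows "rat_fun [:b, a:] [:d, c:] \<circ> rat_fun p q = rat_fun p' q'"
    and "coprime p' q'" and "max (degree p') (degree q') = n"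
proof -
  have lin: "a * x + b * y \<noteq> 0 \<or> c * x + d * y \<noteq> 0" if "x \<noteq> 0 \<or> y \<noteq> 0" for x y
  proof (rule ccontr)
    assume "\<not> ?thesis"
    then have 0: "a * x + b * y = 0" "c * x + d * y = 0" by auto
    have "(a * d - b * c) * x = d * (a * x + b * y) - b * (c * x + d * y)"
      "(a * d - b * c) * y = a * (c * x + d * y) - c * (a * x + b * y)"
      by (simp_all add: algebra_simps)
    then show False using 0 det that by simp
  qed
  have nz: "coeff p n \<noteq> 0 \<or> coeff q n \<noteq> 0"
    using coprime_coeff_max_degree[OF cop] n by simp
  show "coprime p' q'"
    unfolding coprime_complex_poly_iff p'_def q'_def
    using cop lin by (auto simp: coprime_complex_poly_iff)
  have "degree p \<le> n" "degree q \<le> n" using n by auto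
  then show n': "max (degree p') (degree q') = n"
    unfolding p'_def q'_def using lin[OF nz]
    by (intro max_degree_eqI degree_add_le) (auto intro: order_trans[OF degree_smult_le])
  show "rat_fun [:b, a:] [:d, c:] \<circ> rat_fun p q = rat_fun p' q'"
  proof
    fix w show "(rat_fun [:b, a:] [:d, c:] \<circ> rat_fun p q) w = rat_fun p' q' w"
    proof (cases w)
      case None
      then show ?thesis
        using moebius_ratio[OF det nz] by (simp add: rat_fun_None[OF n] rat_fun_None[OF n']) (simp add: p'_def q'_def)
    next
      case (Some z)
      have "poly p z \<noteq> 0 \<or> poly q z \<noteq> 0" using cop by (auto simp: coprime_complex_poly_iff)
      then show ?thesis
        using moebius_ratio[OF det] by (simp add: Some rat_fun_Some p'_def q'_def)
    qed
  qed
qed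

lemma coprime_moebius:
  fixes a b c d :: complex
  assumes "a * d - b * c \<noteq> 0"
  shows "coprime [:b, a:] [:d, c:]" "max (degree [:b, a:]) (degree [:d, c:]) = 1"
proof -
  show "coprime [:b, a:] [:d, c:]"
    unfolding coprime_complex_poly_iff
  proof (intro allI, rule ccontr)
    fix z assume "\<not> (poly [:b, a:] z \<noteq> 0 \<or> poly [:d, c:] z \<noteq> 0)"
    then have "b + z * a = 0" "d + z * c = 0" by auto
    moreover have "a * d - b * c = a * (d + z * c) - c * (b + z * a)" by (simp add: algebra_simps)
    ultimately show False using assms by simp
  qed
  show "max (degree [:b, a:]) (degree [:d, c:]) = 1"
    using assms by auto
qed

lemma moebius_map_rational: "moebius_map M \<Longrightarrow> rational_map_of_degree 1 M"
  unfolding moebius_map_def rational_map_of_degree_def using coprime_moebius by metis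

lemma moebius_comp_rational:
  assumes "moebius_map M" "rational_map_of_degree n f"
  shows "rational_map_of_degree n (M \<circ> f)"
  using assms moebius_comp_rat_fun unfolding moebius_map_def rational_map_of_degree_def by metis

lemma moebius_map_comp:
  assumes "moebius_map M" "moebius_map N"
  shows "moebius_map (M \<circ> N)"
proof -
  obtain a b c d where M: "a * d - b * c \<noteq> 0" "M = rat_fun [:b, a:] [:d, c:]"
    using assms(1) moebius_map_def by auto
  obtain a' b' c' d' where N: "a' * d' - b' * c' \<noteq> 0" "N = rat_fun [:b', a':] [:d', c':]"
    using assms(2) moebius_map_def by auto
  have "M \<circ> N = rat_fun [:a * b' + b * d', a * a' + b * c':] [:c * b' + d * d', c * a' + d * c':]"
    unfolding M(2) N(2) using moebius_comp_rat_fun(1)[OF M(1) coprime_moebius[OF N(1)]] by simp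
  moreover have "(a * a' + b * c') * (c * b' + d * d') - (a * b' + b * d') * (c * a' + d * c')
      = (a * d - b * c) * (a' * d' - b' * c')"
    by (simp add: algebra_simps)
  ultimately show ?thesis
    using M(1) N(1) unfolding moebius_map_def by (metis mult_eq_0_iff)
qed

lemma rat_fun_scalar: "D \<noteq> 0 \<Longrightarrow> rat_fun [:0, D:] [:D:] = id"
  by (rule ext) (auto simp: rat_fun_def split: option.splits)

lemma moebius_map_inverse:
  assumes "moebius_map M"
  obtains N where "moebius_map N" "N \<circ> M = id" "M \<circ> N = id"
proof -
  obtain a b c d where M: "a * d - b * c \<noteq> 0" "M = rat_fun [:b, a:] [:d, c:]"
    using assms(1) moebius_map_def by auto
  define N where "N = rat_fun [:-b, d:] [:a, -c:]"
  have det: "d * a - (-b) * (-c) \<noteq> 0" using M(1) by (simp add: algebra_simps)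
  have "N \<circ> M = rat_fun [:0, a * d - b * c:] [:a * d - b * c:]"
    unfolding M(2) N_def using moebius_comp_rat_fun(1)[OF det coprime_moebius[OF M(1)]]
    by (simp add: algebra_simps)
  moreover have "M \<circ> N = rat_fun [:0, a * d - b * c:] [:a * d - b * c:]"
    unfolding M(2) N_def using moebius_comp_rat_fun(1)[OF M(1) coprime_moebius[OF det]]
    by (simp add: algebra_simps)
  ultimately have "N \<circ> M = id" "M \<circ> N = id" using rat_fun_scalar M(1) by simp_all
  moreover have "moebius_map N" using det N_def moebius_map_def by blast
  ultimately show ?thesis using that by blast
qed

lemma rat_fun_comp_reciprocal:
  assumes cop: "coprime p q" and n: "max (degree p) (degree q) = n"
  shows "rat_fun p q \<circ> rat_fun [:1, a:] [:0, 1:] = rat_fun (reverse_at n a p) (reverse_at n a q)"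
proof
  have le: "degree p \<le> n" "degree q \<le> n" using n by auto
  fix w show "(rat_fun p q \<circ> rat_fun [:1, a:] [:0, 1:]) w = rat_fun (reverse_at n a p) (reverse_at n a q) w"
  proof (cases w)
    case None
    have "rat_fun [:1, a:] [:0, 1:] None = Some a"
      by (simp add: rat_fun_def Let_def)
    then show ?thesis
      using None coprime_reverse_at(2)[OF cop n, of a]
      by (simp add: rat_fun_Some rat_fun_None coeff_reverse_at_top)
  next
    case (Some s)
    show ?thesis
    proof (cases "s = 0")
      case True
      then show ?thesis
        by (simp add: Some rat_fun_Some rat_fun_None[OF n] poly_reverse_at_0 le)
           (simp add: ratio_def rat_fun_None[OF n])
    next
      case False
      then have "rat_fun [:1, a:] [:0, 1:] (Some s) = Some (a + 1 / s)"
        by (simp add: rat_fun_Some ratio_def field_simps)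
      then show ?thesis
        using False by (simp add: Some rat_fun_Some poly_reverse_at le) (simp add: ratio_def)
    qed
  qed
qed

text \<open>For finite \<open>x\<close> the change of coordinate is \<open>s \<mapsto> x + 1 / s\<close>, under which a rational map is
  transformed by \<open>reverse_at\<close>.\<close>

lemma rational_map_normalise_source:
  assumes "rational_map_of_degree n R"
  obtains A where "moebius_map A" "A None = x" "rational_map_of_degree n (R \<circ> A)"
proof (cases x)
  case None
  have "moebius_map id"
    using rat_fun_scalar[of 1] unfolding moebius_map_def
    by (intro exI[of _ 1] exI[of _ 0]) auto
  then show ?thesis using that[of id] None assms by simp
next
  case (Some a)
  obtain p q where R: "coprime p q" "max (degree p) (degree q) = n" "R = rat_fun p q"
    using assms unfolding rational_map_of_degree_def by metis
  define A where "A = rat_fun [:1, a:] [:0, 1:]"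
  have "moebius_map A"
    unfolding moebius_map_def A_def by (intro exI[of _ a] exI[of _ 1] exI[of _ 0]) auto
  moreover have "A None = x"
    by (simp add: A_def rat_fun_def Let_def Some)
  moreover have "rational_map_of_degree n (R \<circ> A)"
    unfolding rational_map_of_degree_def R(3) A_def rat_fun_comp_reciprocal[OF R(1,2)]
    using coprime_reverse_at[OF R(1,2)] by metis
  ultimately show ?thesis using that by blast
qed

text \<open>Besides the derivative of \<open>f\<close> in the charts, this asks that \<open>f\<close> maps a neighbourhood of \<open>w\<close> into
  the domain of the chart at \<open>f w\<close>. Outside that domain \<open>local_coord\<close> has arbitrary values, so the
  chain rule would fail without this condition.\<close>

definition sphere_differentiable :: "(riemann_sphere \<Rightarrow> riemann_sphere) \<Rightarrow> riemann_sphere \<Rightarrow> bool" where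
  "sphere_differentiable f w \<longleftrightarrow>
     local_rep f w field_differentiable at (local_coord w w) \<and>
     (\<forall>\<^sub>F u in nhds (local_coord w w).
        local_param (f w) (local_coord (f w) (f (local_param w u))) = f (local_param w u))"

lemma local_param_local_coord_self [simp]: "local_param w (local_coord w w) = w"
  by (simp add: local_param_def local_coord_def split: option.splits)

lemma local_coord_local_param [simp]: "local_coord w (local_param w u) = u"
  by (simp add: local_param_def local_coord_def split: option.splits)

lemma local_rep_self [simp]: "local_rep f w (local_coord w w) = local_coord (f w) (f w)"
  by (simp add: local_rep_def)

lemma multiplier_id: "multiplier id w = 1"
proof -
  have "local_rep id w = (\<lambda>u. u)" by (auto simp: local_rep_def)
  then show ?thesis by (simp add: multiplier_def)
qed

text \<open>The constant \<open>multiplier\<close> is used below at all points, as the derivative of \<open>f\<close> in the charts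
  at \<open>w\<close> and at \<open>f w\<close>; it is the multiplier proper when \<open>f w = w\<close>.\<close>

lemma critical_point_iff_multiplier:
  "sphere_differentiable f w \<Longrightarrow> critical_point f w \<longleftrightarrow> multiplier f w = 0"
  unfolding sphere_differentiable_def critical_point_def multiplier_def
  using DERIV_imp_deriv field_differentiable_derivI by metis

lemma sphere_chain:
  assumes f: "sphere_differentiable f (g w)" and g: "sphere_differentiable g w"
  shows "sphere_differentiable (f \<circ> g) w"
    and "multiplier (f \<circ> g) w = multiplier f (g w) * multiplier g w"
proof -
  let ?c = "local_coord w w" and ?c' = "local_coord (g w) (g w)"
  have evg: "\<forall>\<^sub>F u in nhds ?c. local_param (g w) (local_rep g w u) = g (local_param w u)"
    using g by (simp add: sphere_differentiable_def local_rep_def)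
  have Dg: "(local_rep g w has_field_derivative multiplier g w) (at ?c)"
    using g by (simp add: sphere_differentiable_def multiplier_def field_differentiable_derivI)
  have Df: "(local_rep f (g w) has_field_derivative multiplier f (g w)) (at (local_rep g w ?c))"
    using f by (simp add: sphere_differentiable_def multiplier_def field_differentiable_derivI)
  have lim: "filterlim (local_rep g w) (nhds ?c') (nhds ?c)"
    using DERIV_isCont[OF Dg] unfolding isCont_def tendsto_at_iff_tendsto_nhds by simp
  have ev: "\<forall>\<^sub>F u in nhds ?c. local_rep (f \<circ> g) w u = (local_rep f (g w) \<circ> local_rep g w) u"
    using evg by eventually_elim (simp add: local_rep_def)
  have D: "(local_rep (f \<circ> g) w has_field_derivative
      multiplier f (g w) * multiplier g w) (at ?c)"
    using DERIV_chain[OF Df Dg] unfolding DERIV_cong_ev[OF refl ev refl] .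
  then show "multiplier (f \<circ> g) w = multiplier f (g w) * multiplier g w"
    by (simp add: multiplier_def DERIV_imp_deriv)
  have "\<forall>\<^sub>F u in nhds ?c. local_param (f (g w)) (local_coord (f (g w)) (f (local_param (g w) (local_rep g w u))))
      = f (local_param (g w) (local_rep g w u))"
    using f lim by (auto simp: sphere_differentiable_def filterlim_iff)
  then have "\<forall>\<^sub>F u in nhds ?c. local_param (f (g w)) (local_coord (f (g w)) (f (g (local_param w u))))
      = f (g (local_param w u))"
    using evg by eventually_elim simp
  then show "sphere_differentiable (f \<circ> g) w"
    using D by (auto simp: sphere_differentiable_def field_differentiable_def)
qed

lemma rat_fun_derivative_finite:
  assumes cop: "coprime p q"
  shows "sphere_differentiable (rat_fun p q) (Some z)"
    and "multiplier (rat_fun p q) (Some z) =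
      (if poly q z = 0 then poly (pderiv q) z / poly p z else poly (wronskian p q) z / poly q z ^ 2)"
proof -
  have *: "sphere_differentiable (rat_fun p q) (Some z) \<and> multiplier (rat_fun p q) (Some z) =
      (if poly q z = 0 then poly (pderiv q) z / poly p z else poly (wronskian p q) z / poly q z ^ 2)"
  proof (cases "poly q z = 0")
    case True
    then have pz: "poly p z \<noteq> 0" using cop by (auto simp: coprime_complex_poly_iff)
    have "local_rep (rat_fun p q) (Some z) = (\<lambda>u. poly q u / poly p u)"
      using True by (auto simp: local_rep_def local_param_def local_coord_def rat_fun_def)
    moreover have "((\<lambda>u. poly q u / poly p u) has_field_derivative poly (pderiv q) z / poly p z) (at z)"
      using has_field_derivative_poly_quotient[OF pz, of q] True pz
      by (simp add: wronskian_def power2_eq_square)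
    moreover have "\<forall>\<^sub>F u in nhds z. poly p u \<noteq> 0"
      using pz by (intro eventually_nhds_in_open[of "{u. poly p u \<noteq> 0}", simplified] open_Collect_neq continuous_intros) auto
    then have "\<forall>\<^sub>F u in nhds z. local_param None (local_coord None (rat_fun p q (Some u))) = rat_fun p q (Some u)"
      by eventually_elim (auto simp: local_param_def local_coord_def rat_fun_def)
    ultimately show ?thesis
      using True by (auto simp: sphere_differentiable_def multiplier_def field_differentiable_def
          DERIV_imp_deriv local_coord_def local_param_def[of "Some z"] rat_fun_def[of p q "Some z"])
  next
    case False
    have "local_rep (rat_fun p q) (Some z) = (\<lambda>u. poly p u / poly q u)"
      using False by (auto simp: local_rep_def local_param_def local_coord_def rat_fun_def)
    moreover have "\<forall>\<^sub>F u in nhds z. poly q u \<noteq> 0"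
      using False by (intro eventually_nhds_in_open[of "{u. poly q u \<noteq> 0}", simplified] open_Collect_neq continuous_intros) auto
    then have "\<forall>\<^sub>F u in nhds z. local_param (Some v) (local_coord (Some v) (rat_fun p q (Some u))) = rat_fun p q (Some u)" for v
      by eventually_elim (auto simp: local_param_def local_coord_def rat_fun_def)
    ultimately show ?thesis
      using has_field_derivative_poly_quotient[OF False, of p] False
      by (auto simp: sphere_differentiable_def multiplier_def field_differentiable_def
          DERIV_imp_deriv local_coord_def local_param_def[of "Some z"] rat_fun_def[of p q "Some z"])
  qed
  then show "sphere_differentiable (rat_fun p q) (Some z)"
    "multiplier (rat_fun p q) (Some z) =
      (if poly q z = 0 then poly (pderiv q) z / poly p z else poly (wronskian p q) z / poly q z ^ 2)"
    by auto
qed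

text \<open>The chart at \<open>\<infinity>\<close> is the composition of the chart at \<open>0\<close> with the inversion \<open>u \<mapsto> 1 / u\<close>, so
  derivatives at \<open>\<infinity>\<close> are derivatives at \<open>0\<close> of the map precomposed with the inversion.\<close>

lemma local_rep_None:
  "local_param None u = rat_fun [:1, 0:] [:0, 1:] (Some u)"
  "local_rep f None = local_rep (f \<circ> rat_fun [:1, 0:] [:0, 1:]) (Some 0)"
  by (auto simp: fun_eq_iff local_rep_def local_param_def rat_fun_def)

lemma multiplier_None:
  "multiplier f None = multiplier (f \<circ> rat_fun [:1, 0:] [:0, 1:]) (Some 0)"
  by (simp add: multiplier_def local_rep_None local_coord_def)

lemma sphere_differentiable_None:
  "sphere_differentiable f None \<longleftrightarrow> sphere_differentiable (f \<circ> rat_fun [:1, 0:] [:0, 1:]) (Some 0)"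
proof -
  have "f None = (f \<circ> rat_fun [:1, 0:] [:0, 1:]) (Some 0)" "local_coord None None = 0" "local_coord (Some 0) (Some 0) = 0"
    by (simp_all add: rat_fun_def local_coord_def)
  moreover have "local_param (Some 0) u = Some u" for u
    by (simp add: local_param_def)
  ultimately show ?thesis
    by (simp add: sphere_differentiable_def local_rep_None)
qed

lemma rational_sphere_differentiable:
  assumes "rational_map_of_degree n R"
  shows "sphere_differentiable R w"
proof -
  obtain p q where R: "coprime p q" "max (degree p) (degree q) = n" "R = rat_fun p q"
    using assms unfolding rational_map_of_degree_def by metis
  show ?thesis
  proof (cases w)
    case None
    then show ?thesis
      using rat_fun_derivative_finite(1)[OF coprime_reverse_at(1)[OF R(1,2)]]
      by (simp only: R(3) sphere_differentiable_None rat_fun_comp_reciprocal[OF R(1,2)])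
  qed (use rat_fun_derivative_finite(1)[OF R(1)] R(3) in simp)
qed

lemma multiplier_rat_fun_None:
  assumes "coprime p q" "degree p = n" "degree q < n"
  shows "multiplier (rat_fun p q) None = coeff q (n - 1) / lead_coeff p"
proof -
  have n: "max (degree p) (degree q) = n" using assms by simp
  have "poly (reverse_at n 0 q) 0 = 0" "poly (reverse_at n 0 p) 0 = lead_coeff p"
    using assms by (simp_all add: poly_reverse_at_0 coeff_eq_0)
  then show ?thesis
    unfolding multiplier_None rat_fun_comp_reciprocal[OF assms(1) n]
    by (simp add: rat_fun_derivative_finite(2)[OF coprime_reverse_at(1)[OF assms(1) n]]
        poly_pderiv_reverse_at_0 assms)
qed

lemma multiplier_moebius_inverse:
  assumes "moebius_map M" "moebius_map N" "N \<circ> M = id"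
  shows "multiplier N (M w) * multiplier M w = 1"
  using sphere_chain(2)[of N M w] assms moebius_map_rational rational_sphere_differentiable multiplier_id
  by metis

text \<open>A Moebius map that fixes \<open>\<infinity>\<close> is affine, so two of its finite values determine it.\<close>

lemma moebius_fixing_infinity:
  assumes M: "moebius_map M" "M None = None" "M (Some u) = Some a" "M (Some v) = Some b" and "u \<noteq> v"
  shows "M = rat_fun [:a - (a - b) / (u - v) * u, (a - b) / (u - v):] [:1:]"
proof -
  obtain \<alpha> \<beta> \<gamma> \<delta> where det: "\<alpha> * \<delta> - \<beta> * \<gamma> \<noteq> 0" and M_eq: "M = rat_fun [:\<beta>, \<alpha>:] [:\<delta>, \<gamma>:]"
    using M(1) moebius_map_def by auto
  have "\<gamma> = 0"
    using M(2) rat_fun_None[OF coprime_moebius(2)[OF det]] unfolding M_eq by (auto simp: ratio_def split: if_splits)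
  then have \<delta>: "\<delta> \<noteq> 0" using det by auto
  have ev: "M (Some z) = Some ((\<beta> + z * \<alpha>) / \<delta>)" for z
    unfolding M_eq using \<delta> by (simp add: rat_fun_Some ratio_def \<open>\<gamma> = 0\<close>)
  have ab: "a = (\<beta> + u * \<alpha>) / \<delta>" "b = (\<beta> + v * \<alpha>) / \<delta>"
    using M(3,4) ev by auto
  then have "a - b = (u - v) * (\<alpha> / \<delta>)" using \<delta> by (simp add: field_simps)
  then have quot: "(a - b) / (u - v) = \<alpha> / \<delta>" using \<open>u \<noteq> v\<close> by simp
  show ?thesis
    unfolding quot
  proof
    fix w show "M w = rat_fun [:a - \<alpha> / \<delta> * u, \<alpha> / \<delta>:] [:1:] w"
    proof (cases w)
      case None
      have "\<alpha> \<noteq> 0" using det \<open>\<gamma> = 0\<close> by auto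
      then show ?thesis using None M(2) \<delta> by (simp add: rat_fun_def Let_def)
    next
      case (Some z)
      then show ?thesis using ev[of z] \<delta> by (simp add: rat_fun_Some ratio_def ab(1) field_simps)
    qed
  qed
qed

section \<open>Fixing a point and two critical points\<close>

text \<open>The maps \<open>A\<close> and \<open>B\<close> carry \<open>\<infinity>\<close> to \<open>x\<close> and \<open>R x\<close> to \<open>\<infinity>\<close>. By the chain rule, critical points of
  \<open>F = B \<circ> R \<circ> A\<close> are carried by \<open>A\<close> to critical points of \<open>R\<close>, so that \<open>F = p / q\<close> satisfies the
  hypotheses of \<open>critical_pair_normalised\<close>. The required \<open>M\<close> is \<open>A \<circ> N \<circ> B\<close>, with \<open>N\<close> the affine map
  that sends the critical values of the pair \<open>a\<close>, \<open>b\<close> back to \<open>a\<close> and \<open>b\<close>.\<close>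

theorem theorem2:
  fixes R :: "riemann_sphere \<Rightarrow> riemann_sphere" and x :: riemann_sphere and n :: nat
  assumes "rational_map_of_degree n R" and "n \<ge> 2"
    and "\<not> critical_value R (R x)"
  shows "\<exists>\<zeta> \<kappa>. \<zeta> \<noteq> \<kappa> \<and> critical_point R \<zeta> \<and> critical_point R \<kappa> \<and>
           (\<exists>M. (moebius_map M \<and> (M \<circ> R) x = x \<and> (M \<circ> R) \<zeta> = \<zeta> \<and> (M \<circ> R) \<kappa> = \<kappa>) \<and>
                (\<forall>N. moebius_map N \<and> (N \<circ> R) x = x \<and> (N \<circ> R) \<zeta> = \<zeta> \<and> (N \<circ> R) \<kappa> = \<kappa>
                      \<longrightarrow> N = M) \<and>
                cmod (multiplier (M \<circ> R) x) \<ge> 1 / 2)"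
proof -
  note diff = rational_sphere_differentiable
  obtain A where A: "moebius_map A" "A None = x" "rational_map_of_degree n (R \<circ> A)"
    using rational_map_normalise_source[OF assms(1)] by metis
  obtain A' where A': "moebius_map A'" "A' \<circ> A = id" "A \<circ> A' = id"
    using moebius_map_inverse[OF A(1)] by blast
  obtain B' where B': "moebius_map B'" "B' None = R x"
    using rational_map_normalise_source[OF assms(1)] by metis
  obtain B where B: "moebius_map B" "B \<circ> B' = id" "B' \<circ> B = id"
    using moebius_map_inverse[OF B'(1)] by blast
  define F where "F = B \<circ> (R \<circ> A)"
  have ratF: "rational_map_of_degree n F"
    unfolding F_def by (rule moebius_comp_rational[OF B(1) A(3)])
  note A'A = pointfree_idE[OF A'(2)] and AA' = pointfree_idE[OF A'(3)]
    and BB' = pointfree_idE[OF B(2)] and B'B = pointfree_idE[OF B(3)]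
  have A'_x: "A' x = None" and B_Rx: "B (R x) = None"
    using A'A[of None] BB'[of None] by (simp_all add: A(2) B'(2))
  have F_None: "F None = None" by (simp add: F_def A(2) B_Rx)
  have B'F: "B' (F w) = R (A w)" for w
    by (simp add: F_def B'B)
  have crit: "critical_point R (A w)" if "multiplier F w = 0" for w
  proof -
    note dA = diff[OF moebius_map_rational[OF A(1)]] and dB = diff[OF moebius_map_rational[OF B(1)]]
      and dR = diff[OF assms(1)]
    have "multiplier F w = multiplier B (R (A w)) * (multiplier R (A w) * multiplier A w)"
      unfolding F_def using sphere_chain[where f = R and g = A, OF dR dA]
        sphere_chain(2)[where f = B and g = "R \<circ> A", OF dB] by simp
    moreover have "multiplier A w \<noteq> 0" "multiplier B (R (A w)) \<noteq> 0"
      using multiplier_moebius_inverse[OF A(1) A'(1,2), of w]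
        multiplier_moebius_inverse[OF B(1) B'(1) B(3), of "R (A w)"] by auto
    ultimately show ?thesis
      using that critical_point_iff_multiplier[OF dR] by simp
  qed
  \<comment> \<open>The poles of \<open>F\<close> correspond to the preimages of \<open>R x\<close> under \<open>R\<close>.\<close>
  have noncrit: "multiplier F w \<noteq> 0" if "F w = None" for w
  proof
    assume "multiplier F w = 0"
    then have "critical_point R (A w)" by (rule crit)
    moreover have "R (A w) = R x" using B'F[of w] that B'(2) by simp
    ultimately show False using assms(3) unfolding critical_value_def by blast
  qed
  obtain p q where F: "coprime p q" "max (degree p) (degree q) = n" "F = rat_fun p q"
    using ratF unfolding rational_map_of_degree_def by metis
  have "coeff q n = 0"
    using F_None unfolding F(3) by (auto simp: rat_fun_None[OF F(2)] ratio_def split: if_splits)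
  then have degq: "degree q < n"
    using F(2) assms(2) by (cases "degree q = n") auto
  then have degp: "degree p = n" using F(2) by auto
  have "coeff q (n - 1) \<noteq> 0"
    using noncrit[OF F_None] multiplier_rat_fun_None[OF F(1) degp degq] F(3) by auto
  then have degq': "degree q = n - 1"
    using degq le_degree[of q "n - 1"] by linarith
  have simple: "poly (pderiv q) z \<noteq> 0" if "poly q z = 0" for z
    using noncrit[of "Some z"] rat_fun_derivative_finite(2)[OF F(1), of z] that
    by (auto simp: F(3) rat_fun_Some ratio_def)
  obtain a b where ab: "poly (wronskian p q) a = 0" "poly (wronskian p q) b = 0"
    "poly q a \<noteq> 0" "poly q b \<noteq> 0" "poly p a / poly q a \<noteq> poly p b / poly q b"
    "cmod (lead_coeff p) * cmod (a - b)
      \<le> 2 * cmod (lead_coeff q) * cmod (poly p a / poly q a - poly p b / poly q b)"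
    using critical_pair_normalised[OF F(1) degp degq' assms(2) simple] by metis
  define u where "u = poly p a / poly q a"
  define v where "v = poly p b / poly q b"
  have uv: "u \<noteq> v" and "a \<noteq> b" using ab by (auto simp: u_def v_def)
  have Fab: "F (Some a) = Some u" "F (Some b) = Some v"
    using ab by (simp_all add: F(3) rat_fun_Some ratio_def u_def v_def)
  have crit_ab: "critical_point R (A (Some a))" "critical_point R (A (Some b))"
    using crit rat_fun_derivative_finite(2)[OF F(1)] ab by (simp_all add: F(3))
  \<comment> \<open>\<open>N\<close> is the affine map that takes \<open>u\<close> to \<open>a\<close> and \<open>v\<close> to \<open>b\<close>.\<close>
  define \<alpha> where "\<alpha> = (a - b) / (u - v)"
  have "\<alpha> \<noteq> 0" using \<open>a \<noteq> b\<close> uv by (simp add: \<alpha>_def)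
  define N where "N = rat_fun [:a - \<alpha> * u, \<alpha>:] [:1:]"
  have N_eq: "N = rat_fun [:a - \<alpha> * u, \<alpha>:] [:1, 0:]" by (simp add: N_def)
  have det: "\<alpha> * 1 - (a - \<alpha> * u) * 0 \<noteq> 0" using \<open>\<alpha> \<noteq> 0\<close> by simp
  have mN: "moebius_map N" unfolding moebius_map_def N_eq using det by blast
  have N_vals: "N None = None" "N (Some u) = Some a" "N (Some v) = Some b"
  proof -
    have "\<alpha> * (u - v) = a - b" using uv by (simp add: \<alpha>_def)
    then show "N None = None" "N (Some u) = Some a" "N (Some v) = Some b"
      using \<open>\<alpha> \<noteq> 0\<close> by (auto simp: N_def rat_fun_def Let_def algebra_simps)
  qed
  define M where "M = A \<circ> (N \<circ> B)"
  have mM: "moebius_map M"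
    unfolding M_def by (intro moebius_map_comp A(1) mN B(1))
  have MR: "M (R (A w)) = A (N (F w))" for w
    by (simp add: M_def F_def)
  \<comment> \<open>In the normalised coordinates \<open>K\<close> fixes \<open>\<infinity>\<close> and maps \<open>u\<close> to \<open>a\<close> and \<open>v\<close> to \<open>b\<close>, like \<open>N\<close>.\<close>
  have unique: "K = M" if K: "moebius_map K" "K (R x) = x"
    "K (R (A (Some a))) = A (Some a)" "K (R (A (Some b))) = A (Some b)" for K
  proof -
    define G where "G = A' \<circ> (K \<circ> B')"
    have G: "moebius_map G" unfolding G_def by (intro moebius_map_comp A'(1) K(1) B'(1))
    have G_None: "G None = None" by (simp add: G_def B'(2) K(2) A'_x)
    have Guv: "G (Some u) = Some a" "G (Some v) = Some b"
      using B'F[of "Some a"] B'F[of "Some b"] K(3,4) A'A by (simp_all add: G_def Fab)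
    have "G = N"
      unfolding N_def \<alpha>_def by (rule moebius_fixing_infinity[OF G G_None Guv uv])
    then have "M = (A \<circ> A') \<circ> K \<circ> (B' \<circ> B)"
      by (simp add: M_def G_def comp_assoc flip: \<open>G = N\<close>)
    then show ?thesis using A'(3) B(3) by simp
  qed
  have "cmod (multiplier (M \<circ> R) x) \<ge> 1 / 2"
  proof -
    define H where "H = N \<circ> F"
    note H = moebius_comp_rat_fun[OF det F(1,2)]
    define p' where "p' = smult \<alpha> p + smult (a - \<alpha> * u) q"
    have H_eq: "H = rat_fun p' q" and cop: "coprime p' q"
      using H(1,2) by (simp_all add: H_def N_eq F(3) p'_def)
    have ratH: "rational_map_of_degree n H"
      unfolding H_def by (rule moebius_comp_rational[OF mN ratF])
    \<comment> \<open>Conjugation by \<open>A\<close> does not change the multiplier, which can thus be computed at \<open>\<infinity>\<close>.\<close>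
    have "M \<circ> R = A \<circ> H \<circ> A'"
    proof
      fix w
      show "(M \<circ> R) w = (A \<circ> H \<circ> A') w"
        using MR[of "A' w"] by (simp add: H_def AA')
    qed
    moreover have "multiplier (A \<circ> H \<circ> A') x = multiplier A (H None) * multiplier H None * multiplier A' x"
      using sphere_chain(2)[where f = "A \<circ> H" and g = A' and w = x] sphere_chain[where f = A and g = H and w = None]
        diff[OF ratH] diff[OF moebius_map_rational[OF A(1)]] diff[OF moebius_map_rational[OF A'(1)]]
      by (simp add: A'_x)
    moreover have "H None = None" by (simp add: H_def F_None N_vals)
    moreover have "multiplier A None * multiplier A' x = 1"
      using multiplier_moebius_inverse[OF A'(1) A(1) A'(3), of x] by (simp add: A'_x)
    ultimately have "multiplier (M \<circ> R) x = multiplier H None"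
      by (simp add: mult_ac)
    also have "\<dots> = lead_coeff q / (\<alpha> * lead_coeff p)"
    proof -
      have "max (degree p') (degree q) = n"
        using H(3) by (simp add: p'_def)
      then have "degree p' = n" using degq by linarith
      moreover have "coeff p' n = \<alpha> * coeff p n"
        by (simp add: p'_def coeff_eq_0[OF degq])
      ultimately show ?thesis
        using multiplier_rat_fun_None[OF cop _ degq] by (simp add: H_eq degq' degp)
    qed
    finally have "multiplier (M \<circ> R) x = lead_coeff q / (\<alpha> * lead_coeff p)" .
    then have eq: "cmod (multiplier (M \<circ> R) x) = cmod (lead_coeff q) * cmod (u - v) / (cmod (a - b) * cmod (lead_coeff p))"
      by (simp add: norm_divide norm_mult \<alpha>_def)
    have "p \<noteq> 0" using degp assms(2) by auto
    then have "cmod (a - b) * cmod (lead_coeff p) > 0" using \<open>a \<noteq> b\<close> by simp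
    then show ?thesis
      unfolding eq using ab(6) by (simp add: u_def v_def field_simps)
  qed
  then have "\<exists>M. (moebius_map M \<and> (M \<circ> R) x = x \<and> (M \<circ> R) (A (Some a)) = A (Some a) \<and>
        (M \<circ> R) (A (Some b)) = A (Some b)) \<and>
      (\<forall>N. moebius_map N \<and> (N \<circ> R) x = x \<and> (N \<circ> R) (A (Some a)) = A (Some a) \<and>
        (N \<circ> R) (A (Some b)) = A (Some b) \<longrightarrow> N = M) \<and>
      cmod (multiplier (M \<circ> R) x) \<ge> 1 / 2"
  proof (intro exI[of _ M] conjI allI impI)
    show "(M \<circ> R) x = x" "(M \<circ> R) (A (Some a)) = A (Some a)" "(M \<circ> R) (A (Some b)) = A (Some b)"
      using MR[of None] MR[of "Some a"] MR[of "Some b"] by (simp_all add: A(2) F_None Fab N_vals)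
  next
    fix K
    assume "moebius_map K \<and> (K \<circ> R) x = x \<and> (K \<circ> R) (A (Some a)) = A (Some a) \<and>
      (K \<circ> R) (A (Some b)) = A (Some b)"
    then show "K = M" by (intro unique) simp_all
  qed (rule mM)
  moreover have "A (Some a) \<noteq> A (Some b)"
    using A'A[of "Some a"] A'A[of "Some b"] \<open>a \<noteq> b\<close> by auto
  ultimately show ?thesis
    using crit_ab by blast
qed

end
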